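(* Assume that the Bateman--Horn conjecture holds. Let $k$ be a positive even integer with $k \equiv 0 \pmod 3$, and let $\Pi_k$, $T$, $Q^{\pm}$, $L_k^{\pm}$, $R_k^{\pm}$ be as defined in the context. Then, for each choice of sign $\pm$, the set of primes $p \in \Pi_k$ for which $\operatorname{sgn} T(p) = \pm 1$ has lower density (as a subset of $\Pi_k$) at least $$\prod_{q \in Q^{\pm}} (q-2)^{-1}\left(1 - \frac{R_k^{\pm}}{L_k^{\pm}}\right) > 0.$$
   Context: The letters $p,q,r$ denote primes. $\varphi$ is Euler's totient function. For a positive even integer $k$, $\Pi_k$ is the set of primes $p$ such that $p+k$ is also prime, $\Pi_k(x) = \{p \in \Pi_k : p \le x\}$, and $\pi_k(x) = \#\Pi_k(x)$. Set $T(p) = \varphi(p-1) - \varphi(p+k-1)$. The lower density of $A \subseteq \Pi_k$ as a subset of $\Pi_k$ is $\liminf_{x\to\infty} \#\{p \in A : p \le x\}/\pi_k(x)$. Bateman--Horn conjecture: let $f_1,\dots,f_m$ be distinct irreducible polynomials with integer coefficients and positive leading coefficients such that $f = f_1\cdots f_m$ does not vanish identically modulo any prime. Let $P(x)$ be the number of positive integers $n \le x$ such that $f_1(n),\dots,f_m(n)$ are all prime. Then $P(x) \sim \frac{C}{D}\int_2^x \frac{dt}{(\log t)^m}$ as $x \to \infty$, where $D = \prod_{i=1}^m \deg f_i$, $C = \prod_p \frac{1 - N_f(p)/p}{(1-1/p)^m}$ (product over all primes $p$ in increasing order), and $N_f(p)$ is the number of solutions of $f(n) \equiv 0 \pmod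 p$ in residue classes modulo $p$. Assuming the conjecture means assuming it for all such collections. From now on $k$ is a positive even integer with $k \equiv 0 \pmod 3$. For $f(t) = t(t+k)$ one has, for a prime $r$, $N_f(r) = 1$ if $r \mid k$ and $N_f(r) = 2$ if $r \nmid k$. Fix a sign; upper signs are read together and lower signs are read together throughout. Let $q_1 < q_2 < \cdots$ be the increasing sequence of all primes that do not divide $k(k \mp 1)$ (so for the sign $+$ the primes not dividing $k(k-1)$, and for the sign $-$ the primes not dividing $k(k+1)$). For an index $m$ put $Q^{\pm} = \{q_1,\dots,q_m\}$ and $$L_k^{\pm} = \log\left[\prod_{q \in Q^{\pm}}\left(1 + \frac{1}{q-1}\right)\right], \qquad R_k^{\pm} = \sum_{\substack{r \ge 5,\ r \notin Q^{\pm} \\ r \nmid (k \pm 1)}} \frac{1}{r - N_f(r)}\log\left(1 + \frac{1}{r-1}\right),$$ the sum being over primes $r$. The index $m$ is chosen to be the smallest one for which $L_k^{\pm} > R_k^{\pm}$, and $Q^{\pm}$, $L_k^{\pm}$, $R_k^{\pm}$ denote the corresponding objects for this $m$. *)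

theory Defs
  imports
    "HOL-Analysis.Analysis"
    "HOL-Computational_Algebra.Computational_Algebra"
    "HOL-Library.Landau_Symbols"
    "HOL-Number_Theory.Totient"
begin

definition num_roots_mod :: "int poly \<Rightarrow> nat \<Rightarrow> nat" where
  "num_roots_mod f p = card {a\<in>{0..<p}. int p dvd poly f (int a)}"

definition bh_count :: "int poly set \<Rightarrow> real \<Rightarrow> nat" where
  "bh_count F x = card {n::nat. 0 < n \<and> real n \<le> x \<and> (\<forall>f\<in>F. prime (poly f (int n)))}"

text \<open>The product over all primes is only conditionally convergent in general, so it is
  taken as the limit of the partial products over the primes up to \<open>N\<close>.\<close>

definition bh_const :: "int poly set \<Rightarrow> real" where
  "bh_const F = lim (\<lambda>N::nat. \<Prod>p | prime p \<and> p \<le> N.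
     (1 - real (num_roots_mod (\<Prod>F) p) / real p) / (1 - 1 / real p) ^ card F)"

text \<open>Irreducibility is in \<open>\<int>[X]\<close>.  Given the last condition of admissibility (which
  forces every member to be primitive and nonconstant) this agrees with irreducibility in
  \<open>\<rat>[X]\<close>.  Vanishing modulo \<open>p\<close> is meant for the values of the product, not for its
  coefficients.\<close>

definition bh_admissible :: "int poly set \<Rightarrow> bool" where
  "bh_admissible F \<longleftrightarrow>
     finite F \<and> F \<noteq> {} \<and>
     (\<forall>f\<in>F. irreducible f \<and> lead_coeff f > 0) \<and>
     (\<forall>p::nat. prime p \<longrightarrow> (\<exists>n::int. \<not> int p dvd poly (\<Prod>F) n))"

definition Bateman_Horn_conjecture :: bool where
  "Bateman_Horn_conjecture \<longleftrightarrow>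
     (\<forall>F. bh_admissible F \<longrightarrow>
       (\<lambda>x::real. real (bh_count F x)) \<sim>[at_top]
       (\<lambda>x. bh_const F / real (\<Prod>f\<in>F. degree f) * integral {2..x} (\<lambda>t. 1 / ln t ^ card F)))"

definition prime_pairs :: "nat \<Rightarrow> nat set" where
  "prime_pairs k = {p. prime p \<and> prime (p + k)}"

definition T :: "nat \<Rightarrow> nat \<Rightarrow> int" where
  "T k p = int (totient (p - 1)) - int (totient (p + k - 1))"

definition lower_density_in :: "nat set \<Rightarrow> nat set \<Rightarrow> ereal" where
  "lower_density_in A B =
     Liminf at_top (\<lambda>x::real.
       ereal (real (card {p\<in>A. real p \<le> x}) / real (card {p\<in>B. real p \<le> x})))"

text \<open>In what follows the sign is an integer \<open>s\<close>, equal to \<open>1\<close> or \<open>-1\<close>; thus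
  \<open>k \<mp> 1\<close> is \<open>k - s\<close> and \<open>k \<plusminus> 1\<close> is \<open>k + s\<close>.  The library function
  \<open>enumerate\<close> counts from 0, whereas \<open>q_seq\<close> counts from 1.\<close>

definition q_seq :: "nat \<Rightarrow> int \<Rightarrow> nat \<Rightarrow> nat" where
  "q_seq k s j = enumerate {q. prime q \<and> \<not> int q dvd int k * (int k - s)} (j - 1)"

definition Q_upto :: "nat \<Rightarrow> int \<Rightarrow> nat \<Rightarrow> nat set" where
  "Q_upto k s m = q_seq k s ` {1..m}"

definition L_upto :: "nat \<Rightarrow> int \<Rightarrow> nat \<Rightarrow> real" where
  "L_upto k s m = ln (\<Prod>q\<in>Q_upto k s m. 1 + 1 / (real q - 1))"

definition R_upto :: "nat \<Rightarrow> int \<Rightarrow> nat \<Rightarrow> real" where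
  "R_upto k s m =
     (\<Sum>\<^sub>\<infinity>r\<in>{r. prime r \<and> 5 \<le> r \<and> r \<notin> Q_upto k s m \<and> \<not> int r dvd int k + s}.
        1 / (real r - real (num_roots_mod [:0, int k, 1:] r)) * ln (1 + 1 / (real r - 1)))"

text \<open>A suitable \<open>m\<close> exists, since \<open>L_upto\<close> is unbounded in \<open>m\<close> while
  \<open>R_upto\<close> is bounded.\<close>

definition m_index :: "nat \<Rightarrow> int \<Rightarrow> nat" where
  "m_index k s = (LEAST m. 1 \<le> m \<and> L_upto k s m > R_upto k s m)"

definition Q_set :: "nat \<Rightarrow> int \<Rightarrow> nat set" where
  "Q_set k s = Q_upto k s (m_index k s)"

definition L_val :: "nat \<Rightarrow> int \<Rightarrow> real" where
  "L_val k s = L_upto k s (m_index k s)"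

definition R_val :: "nat \<Rightarrow> int \<Rightarrow> real" where
  "R_val k s = R_upto k s (m_index k s)"

end

theory Submission
  imports Defs "HOL-Real_Asymp.Real_Asymp"
begin

text \<open>Write \<open>A\<close> and \<open>B\<close> for the numbers \<open>p - 1\<close> and \<open>p + k - 1\<close>, named so that the sign of
\<open>T k p\<close> is \<open>s\<close> exactly when \<open>\<phi>(A) < \<phi>(B)\<close>; thus \<open>A = p + k - 1\<close> for \<open>s = 1\<close> and
\<open>A = p - 1\<close> for \<open>s = -1\<close>.  Since \<open>ln n - ln \<phi>(n)\<close> is the sum of \<open>ln (1 + 1/(r - 1))\<close> over the
primes \<open>r\<close> dividing \<open>n\<close>, and since \<open>ln A - ln B\<close> tends to 0, the sign is \<open>s\<close> as soon as the primes
dividing \<open>A\<close> contribute noticeably more to such sums than those dividing \<open>B\<close>.  The primes 2 and 3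
divide \<open>k\<close>, so they divide both numbers or neither, and cancel.

Restrict \<open>p\<close> to the residue class in which \<open>A\<close> is divisible by all primes of \<open>Q\<close>.  The
contribution of \<open>A\<close> is then at least \<open>L\<close> (beyond 2 and 3).  By the Bateman--Horn conjecture this class
contains the proportion \<open>\<Prod>q\<in>Q. 1/(q - 2)\<close> of the prime pairs, and among its members a prime
\<open>r \<ge> 5\<close> that is not in \<open>Q\<close> and does not divide \<open>k + s\<close> divides \<open>B\<close> in the proportion \<open>1/(r - N(r))\<close>, where \<open>N(r)\<close> is the number of roots of
\<open>t (t + k)\<close> modulo \<open>r\<close>.  The contribution of \<open>B\<close> therefore has mean \<open>R < L\<close>, and by
Markov's inequality it exceeds \<open>L - \<epsilon>\<close> for a proportion of the class that is asymptotically at most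
\<open>R/(L - \<epsilon>)\<close>.  For \<open>\<epsilon> \<rightarrow> 0\<close> this gives the bound of the theorem.

The delicate point is the mean value, where the limit \<open>x \<rightarrow> \<infinity>\<close> is interchanged with an infinite
sum over \<open>r\<close>, while the conjecture says nothing uniform in \<open>r\<close>.  The interchange (Tannery's theorem)
needs a summable majorant, and this comes from an unconditional estimate
(\<open>prime_pairs_class_uniform_bound\<close>): for large \<open>x\<close> and up to a constant, at most \<open>x / (\<surd>r (ln x)\<^sup>2)\<close> primes
\<open>p \<le> x\<close> with \<open>p + k\<close> prime lie in a given residue class modulo a prime \<open>r \<le> 2 x\<close>.  For
\<open>r\<close> beyond a small power of \<open>x\<close> the trivial bound suffices.  For smaller \<open>r\<close> it is Selberg's upper bound sieve
for \<open>n (n + k)\<close> (\<open>selberg_upper_bound\<close>), together with the lower bound of order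
\<open>(ln D)\<^sup>2\<close> for its mass (\<open>sieve_mass_lower_bound\<close>).  The remaining pillars are the
proportion of prime pairs in a residue class (\<open>prime_pairs_class_proportion\<close>), the mean value
(\<open>mean_opposing_sum\<close>), the comparison of totients (\<open>opposing_sum_small_imp_sgn_T\<close>) and
the inequality \<open>0 \<le> R < L\<close> (\<open>R_val_less_L_val\<close>).\<close>

section \<open>Sums of local factors over a residue class\<close>

lemma cong_pair_iff_cong_mult:
  fixes a b q l :: nat
  assumes "coprime q l"
  obtains c where "\<And>n. [n = a] (mod q) \<and> [n = b] (mod l) \<longleftrightarrow> [n = c] (mod (q * l))"
proof -
  obtain c where c: "[c = a] (mod q)" "[c = b] (mod l)"
    using binary_chinese_remainder_nat[OF assms] by blast
  have "[n = a] (mod q) \<and> [n = b] (mod l) \<longleftrightarrow> [n = c] (mod (q * l))" for n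
  proof
    assume "[n = a] (mod q) \<and> [n = b] (mod l)"
    then have "[n = c] (mod q)" "[n = c] (mod l)"
      using c cong_trans cong_sym by blast+
    then show "[n = c] (mod (q * l))"
      using assms by (simp add: coprime_cong_mult_nat)
  next
    assume "[n = c] (mod (q * l))"
    then have "[n = c] (mod q)" "[n = c] (mod l)"
      by (auto intro: cong_modulus_mult_nat) (metis cong_modulus_mult_nat mult.commute)
    then show "[n = a] (mod q) \<and> [n = b] (mod l)"
      using c cong_trans by blast
  qed
  then show thesis using that by blast
qed

lemma card_residue_class_upto:
  fixes q a b N :: nat
  assumes "1 \<le> b" "b \<le> q" "[a = b] (mod q)"
  shows "card {n\<in>{1..N}. [n = a] (mod q)} = (N + q - b) div q"
proof (induction N)
  case 0
  have "(q - b) div q = 0"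
    using assms by (intro div_less) auto
  then show ?case by simp
next
  case (Suc N)
  have ab: "[n = a] (mod q) \<longleftrightarrow> [n = b] (mod q)" for n
    using assms(3) by (meson cong_sym cong_trans)
  have e: "Suc N + q - b = Suc (N + q - b)" using assms by simp
  have "Suc (N + q - b) mod q = 0 \<longleftrightarrow> [Suc N = b] (mod q)"
  proof -
    have "Suc (N + q - b) mod q = 0 \<longleftrightarrow> q dvd (Suc N + q - b)" by (simp only: e dvd_eq_mod_eq_0)
    also have "\<dots> \<longleftrightarrow> [Suc N + q = b] (mod q)"
      using assms by (metis cong_sym cong_altdef_nat' cong_to_1_nat e le_add2 le_trans cong_altdef_nat)
    also have "\<dots> \<longleftrightarrow> [Suc N = b] (mod q)"
      unfolding cong_def by (metis add_Suc mod_add_self2)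
    finally show ?thesis .
  qed
  moreover have "{n\<in>{1..Suc N}. [n = a] (mod q)} =
     (if [Suc N = a] (mod q) then insert (Suc N) {n\<in>{1..N}. [n = a] (mod q)}
      else {n\<in>{1..N}. [n = a] (mod q)})"
    by (auto simp: le_Suc_eq)
  ultimately show ?case using Suc
    by (simp only: e div_Suc) (auto simp: ab)
qed

lemma card_residue_class_approx:
  fixes q a N :: nat
  assumes "q > 0"
  shows "\<bar>real (card {n\<in>{1..N}. [n = a] (mod q)}) - real N / real q\<bar> \<le> 1"
proof -
  define b where "b = (if a mod q = 0 then q else a mod q)"
  have b: "1 \<le> b" "b \<le> q" "[a = b] (mod q)"
    using assms by (auto simp: b_def cong_def)
  define m where "m = N + q - b"
  have m: "real m = real N + real q - real b"
    using b by (simp add: m_def of_nat_diff)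
  have d: "real m = real q * real (m div q) + real (m mod q)"
    by (metis mult_div_mod_eq of_nat_add of_nat_mult)
  have lt: "real (m mod q) \<le> real q" "real b \<le> real q" "1 \<le> real b"
    using assms b by (auto intro: less_imp_le)
  have "real (m div q) - real N / real q = (real q - real b - real (m mod q)) / real q"
    using m d assms by (simp add: field_simps)
  also have "\<bar>\<dots>\<bar> \<le> 1"
  proof -
    have "\<bar>real q - real b - real (m mod q)\<bar> \<le> real q"
      using lt by linarith
    then show ?thesis using assms by (simp add: abs_divide)
  qed
  finally show ?thesis
    using card_residue_class_upto[OF b, of N] by (simp add: m_def)
qed

text \<open>The factors belonging to different primes are independent, each with mean \<open>1 + 2 c(l)/l\<close> because
\<open>n (n + k)\<close> has the two roots \<open>0\<close> and \<open>-k\<close> modulo \<open>l\<close>.  Expanding one factor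
replaces the residue class modulo \<open>q\<close> by itself and by two classes modulo \<open>q l\<close>, so that main
term and error both follow by induction on the set of primes, for all moduli at once.\<close>

lemma twisted_sum_residue_class:
  fixes U :: "nat set" and c :: "nat \<Rightarrow> real" and k q a N :: nat
  assumes "finite U" "q > 0"
    and "\<And>l. l \<in> U \<Longrightarrow> prime l \<and> \<not> l dvd k \<and> \<not> l dvd q"
  shows "\<bar>(\<Sum>n | n \<in> {1..N} \<and> [n = a] (mod q). \<Prod>l\<in>U. 1 + c l * of_bool (l dvd n * (n + k)))
            - real N / real q * (\<Prod>l\<in>U. 1 + c l * (2 / real l))\<bar>
         \<le> (\<Prod>l\<in>U. 1 + 2 * \<bar>c l\<bar>)"
  using assms
proof (induction U arbitrary: q a rule: finite_induct)
  case empty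
  then show ?case using card_residue_class_approx[of q N a] by simp
next
  case (insert l U)
  define P :: "nat \<Rightarrow> real" where "P n = (\<Prod>l\<in>U. 1 + c l * of_bool (l dvd n * (n + k)))" for n
  define A where "A q a = {n. n \<in> {1..N} \<and> [n = a] (mod q)}" for q a
  define M where "M = (\<Prod>l\<in>U. 1 + c l * (2 / real l))"
  define E where "E = (\<Prod>l\<in>U. 1 + 2 * \<bar>c l\<bar>)"
  have fA: "finite (A q a)" for q a by (simp add: A_def)
  have l: "prime l" "\<not> l dvd k" "\<not> l dvd q" using insert by auto
  have l0: "l > 0" using l by (simp add: prime_gt_0_nat)
  have IH: "\<bar>(\<Sum>n\<in>A q' a'. P n) - real N / real q' * M\<bar> \<le> E"
    if "q' > 0" "\<And>l. l \<in> U \<Longrightarrow> \<not> l dvd q'" for q' a'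
    using insert.IH[of q' a'] insert.prems that unfolding A_def P_def M_def E_def by blast
  have ql: "l' \<in> U \<Longrightarrow> \<not> l' dvd q * l" for l'
    using insert by (metis insertCI l(1) prime_dvd_mult_iff primes_dvd_imp_eq)
  have cop: "coprime q l"
    using l by (simp add: prime_imp_coprime coprime_commute)
  obtain a1 where a1: "\<And>n. [n = a] (mod q) \<and> [n = 0] (mod l) \<longleftrightarrow> [n = a1] (mod (q * l))"
    using cong_pair_iff_cong_mult[OF cop] by metis
  obtain a2 where a2: "\<And>n. [n = a] (mod q) \<and> [n = k * (l - 1)] (mod l) \<longleftrightarrow> [n = a2] (mod (q * l))"
    using cong_pair_iff_cong_mult[OF cop] by metis
  have shift: "[n = k * (l - 1)] (mod l) \<longleftrightarrow> l dvd n + k" for n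
  proof -
    have "[n = k * (l - 1)] (mod l) \<longleftrightarrow> [n + k = k * (l - 1) + k] (mod l)"
      by (simp add: cong_add_rcancel_nat)
    also have "k * (l - 1) + k = k * l"
      using l0 by (cases l) auto
    also have "[n + k = k * l] (mod l) \<longleftrightarrow> l dvd n + k"
      by (simp add: cong_def dvd_eq_mod_eq_0)
    finally show ?thesis .
  qed
  have split: "{n \<in> A q a. l dvd n * (n + k)} = A (q * l) a1 \<union> A (q * l) a2"
    unfolding A_def using a1 a2 shift l
    by (auto simp: prime_dvd_mult_iff cong_0_iff)
  have disj: "A (q * l) a1 \<inter> A (q * l) a2 = {}"
  proof -
    have False if "[n = a1] (mod (q * l))" "[n = a2] (mod (q * l))" for n
      using that a1[of n] a2[of n] shift[of n] l(2) by (simp add: cong_0_iff dvd_add_right_iff)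
    then show ?thesis by (auto simp: A_def)
  qed
  have "(\<Sum>n\<in>A q a. \<Prod>l\<in>insert l U. 1 + c l * of_bool (l dvd n * (n + k)))
      = (\<Sum>n\<in>A q a. P n + c l * (of_bool (l dvd n * (n + k)) * P n))"
    using insert.hyps by (intro sum.cong refl) (simp add: P_def algebra_simps)
  also have "\<dots> = (\<Sum>n\<in>A q a. P n) + c l * (\<Sum>n\<in>A q a. of_bool (l dvd n * (n + k)) * P n)"
    by (simp add: sum.distrib sum_distrib_left)
  also have "(\<Sum>n\<in>A q a. of_bool (l dvd n * (n + k)) * P n) = (\<Sum>n\<in>{n\<in>A q a. l dvd n * (n + k)}. P n)"
    using fA by (intro sum.mono_neutral_cong_right) auto
  also have "\<dots> = (\<Sum>n\<in>A (q * l) a1. P n) + (\<Sum>n\<in>A (q * l) a2. P n)"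
    unfolding split using disj fA by (simp add: sum.union_disjoint)
  finally have eq: "(\<Sum>n\<in>A q a. \<Prod>l\<in>insert l U. 1 + c l * of_bool (l dvd n * (n + k)))
     = (\<Sum>n\<in>A q a. P n) + c l * ((\<Sum>n\<in>A (q * l) a1. P n) + (\<Sum>n\<in>A (q * l) a2. P n))" .
  have e0: "\<bar>(\<Sum>n\<in>A q a. P n) - real N / real q * M\<bar> \<le> E"
    using insert by (intro IH) auto
  have e1: "\<bar>(\<Sum>n\<in>A (q * l) a'. P n) - real N / real (q * l) * M\<bar> \<le> E" for a'
    using insert l0 ql by (intro IH) auto
  have "\<bar>((\<Sum>n\<in>A q a. P n) - real N / real q * M)
      + c l * (((\<Sum>n\<in>A (q * l) a1. P n) - real N / real (q * l) * M)
             + ((\<Sum>n\<in>A (q * l) a2. P n) - real N / real (q * l) * M))\<bar>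
      \<le> E + \<bar>c l\<bar> * (E + E)"
    by (intro order_trans[OF abs_triangle_ineq] add_mono e0 order_trans[OF eq_refl[OF abs_mult]]
          mult_left_mono e1) auto
  moreover have "((\<Sum>n\<in>A q a. P n) - real N / real q * M)
      + c l * (((\<Sum>n\<in>A (q * l) a1. P n) - real N / real (q * l) * M)
             + ((\<Sum>n\<in>A (q * l) a2. P n) - real N / real (q * l) * M))
    = (\<Sum>n\<in>A q a. \<Prod>l\<in>insert l U. 1 + c l * of_bool (l dvd n * (n + k)))
      - real N / real q * ((1 + c l * (2 / real l)) * M)"
    unfolding eq using l0 insert.prems by (simp add: field_simps)
  moreover have "E + \<bar>c l\<bar> * (E + E) = (1 + 2 * \<bar>c l\<bar>) * E" by (simp add: algebra_simps)
  ultimately show ?case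
    using insert.hyps by (simp add: A_def M_def E_def)
qed

section \<open>Selberg's upper bound sieve for \<open>n (n + k)\<close>\<close>

definition sieve_weight :: "nat set \<Rightarrow> real" where
  "sieve_weight W = (\<Prod>l\<in>W. 2 / (real l - 2))"

definition sieve_support :: "nat set \<Rightarrow> real \<Rightarrow> nat set set" where
  "sieve_support P D = {W. W \<subseteq> P \<and> real (\<Prod>W) \<le> D}"

definition sieve_mass :: "nat set \<Rightarrow> real \<Rightarrow> real" where
  "sieve_mass P D = (\<Sum>W\<in>sieve_support P D. sieve_weight W)"

text \<open>Each factor has mean 0 over the residues modulo \<open>l\<close> and second moment \<open>(l - 2)/2\<close>, the
reciprocal of the factor of \<open>sieve_weight\<close>.  Over a complete period these functions are therefore
orthogonal, and all of them equal 1 at an \<open>n\<close> that survives the sieve.\<close>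

definition centred :: "nat \<Rightarrow> nat set \<Rightarrow> nat \<Rightarrow> real" where
  "centred k W n = (\<Prod>l\<in>W. 1 - real l / 2 * of_bool (l dvd n * (n + k)))"

lemma prod_extend_by_one:
  assumes "finite U" "W \<subseteq> U"
  shows "(\<Prod>x\<in>W. f x) = (\<Prod>x\<in>U. if x \<in> W then f x else 1)"
  using assms by (intro prod.mono_neutral_cong_left) auto

text \<open>Orthogonality on an interval instead of a complete period: the product of the two functions is again a
product of local factors.  A prime that lies in only one of the two sets contributes a vanishing mean,
and a common prime contributes its second moment.\<close>

lemma centred_correlation:
  fixes W V :: "nat set" and k q a N :: nat and D :: real
  assumes fin: "finite W" "finite V" and q: "q > 0"
    and pr: "\<And>l. l \<in> W \<union> V \<Longrightarrow> prime l \<and> 2 < l \<and> \<not> l dvd k \<and> \<not> l dvd q"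
    and D: "real (\<Prod>W) \<le> D" "real (\<Prod>V) \<le> D"
  shows "(\<Sum>n | n \<in> {1..N} \<and> [n = a] (mod q). centred k W n * centred k V n)
         \<le> (if W = V then real N / (real q * sieve_weight W) else 0) + D ^ 4"
proof -
  define U where "U = W \<union> V"
  define c where "c l = (if l \<in> W \<inter> V then (real l)\<^sup>2 / 4 - real l else - real l / 2)" for l :: nat
  have fU: "finite U" using fin by (simp add: U_def)
  have gt2: "real l > 2" if "l \<in> U" for l
    using pr[of l] that by (auto simp: U_def)
  have twisted: "centred k W n * centred k V n = (\<Prod>l\<in>U. 1 + c l * of_bool (l dvd n * (n + k)))" for n
  proof -
    have "centred k W n * centred k V n
      = (\<Prod>l\<in>U. (if l \<in> W then 1 - real l / 2 * of_bool (l dvd n * (n + k)) else 1)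
              * (if l \<in> V then 1 - real l / 2 * of_bool (l dvd n * (n + k)) else 1))"
      unfolding centred_def prod.distrib using fU
      by (simp add: U_def flip: prod_extend_by_one)
    \<comment> \<open>For a prime in both sets, \<open>(1 - l/2)\<^sup>2 = 1 + (l\<^sup>2/4 - l)\<close>.\<close>
    also have "\<dots> = (\<Prod>l\<in>U. 1 + c l * of_bool (l dvd n * (n + k)))"
      by (intro prod.cong refl) (auto simp: U_def c_def power2_eq_square field_simps)
    finally show ?thesis .
  qed
  have main: "(\<Prod>l\<in>U. 1 + c l * (2 / real l)) = (if W = V then 1 / sieve_weight W else 0)"
  proof (cases "W = V")
    case True
    have "(\<Prod>l\<in>U. 1 + c l * (2 / real l)) = (\<Prod>l\<in>W. 1 / (2 / (real l - 2)))"
      using gt2 True by (intro prod.cong) (force simp: U_def c_def power2_eq_square field_simps)+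
    also have "\<dots> = 1 / sieve_weight W"
      unfolding sieve_weight_def by (simp only: prod_dividef prod.neutral_const)
    finally show ?thesis using True by simp
  next
    case False
    then obtain l where l: "l \<in> U" "l \<notin> W \<inter> V" by (auto simp: U_def)
    then have "1 + c l * (2 / real l) = 0" using gt2[of l] by (auto simp: c_def)
    then show ?thesis using False l fU by (auto simp: prod_zero_iff)
  qed
  have err: "(\<Prod>l\<in>U. 1 + 2 * \<bar>c l\<bar>) \<le> D ^ 4"
  proof -
    have "(\<Prod>l\<in>U. 1 + 2 * \<bar>c l\<bar>)
       \<le> (\<Prod>l\<in>U. (if l \<in> W then (real l)\<^sup>2 else 1) * (if l \<in> V then (real l)\<^sup>2 else 1))"
    proof (intro prod_mono conjI)
      fix l assume l: "l \<in> U"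
      define t where "t = real l"
      have t: "t > 2" using gt2[OF l] by (simp add: t_def)
      have sq: "t\<^sup>2 \<ge> 2 * t" using t by (simp add: power2_eq_square)
      have a: "1 + t \<le> t\<^sup>2" using sq t by linarith
      have "t\<^sup>2 * t\<^sup>2 \<ge> 4 * t\<^sup>2"
        using sq t by (intro mult_right_mono) auto
      then have b: "1 + 2 * \<bar>t\<^sup>2 / 4 - t\<bar> \<le> t\<^sup>2 * t\<^sup>2"
        using sq t unfolding abs_real_def by (auto split: if_split)
      show "1 + 2 * \<bar>c l\<bar> \<le> (if l \<in> W then (real l)\<^sup>2 else 1) * (if l \<in> V then (real l)\<^sup>2 else 1)"
        using l a b by (auto simp: c_def t_def U_def)
    qed auto
    also have "\<dots> = (\<Prod>l\<in>W. (real l)\<^sup>2) * (\<Prod>l\<in>V. (real l)\<^sup>2)"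
      unfolding prod.distrib using fU by (simp add: U_def flip: prod_extend_by_one)
    also have "\<dots> = (real (\<Prod>W))\<^sup>2 * (real (\<Prod>V))\<^sup>2"
      by (simp add: prod_power_distrib)
    also have "\<dots> \<le> D\<^sup>2 * D\<^sup>2"
      by (intro mult_mono power_mono D) (auto intro: prod_nonneg)
    finally show ?thesis by (simp add: power2_eq_square power4_eq_xxxx mult_ac)
  qed
  have "\<bar>(\<Sum>n | n \<in> {1..N} \<and> [n = a] (mod q). \<Prod>l\<in>U. 1 + c l * of_bool (l dvd n * (n + k)))
            - real N / real q * (\<Prod>l\<in>U. 1 + c l * (2 / real l))\<bar>
         \<le> (\<Prod>l\<in>U. 1 + 2 * \<bar>c l\<bar>)"
    using pr by (intro twisted_sum_residue_class fU q) (auto simp: U_def)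
  then show ?thesis
    unfolding twisted[symmetric] main using err by (auto split: if_splits simp: abs_le_iff mult.commute)
qed

lemma finite_sieve_support: "finite P \<Longrightarrow> finite (sieve_support P D)"
  unfolding sieve_support_def by (rule finite_subset[of _ "Pow P"]) auto

lemma sieve_weight_pos:
  assumes "\<And>l. l \<in> W \<Longrightarrow> 2 < l"
  shows "sieve_weight W > 0"
  unfolding sieve_weight_def using assms by (intro prod_pos) force

lemma sieve_mass_ge_1:
  assumes "finite P" "\<And>l. l \<in> P \<Longrightarrow> 2 < l" "D \<ge> 1"
  shows "sieve_mass P D \<ge> 1"
proof -
  have "sieve_weight {} \<le> sieve_mass P D" unfolding sieve_mass_def
    using assms by (intro member_le_sum finite_sieve_support)
      (auto simp: sieve_support_def intro!: less_imp_le[OF sieve_weight_pos])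
  then show ?thesis by (simp add: sieve_weight_def)
qed

text \<open>The function \<open>F = \<Sum>W. sieve_weight W * centred k W\<close> over the sieve support takes the
value \<open>G = sieve_mass P D\<close> at every \<open>n\<close> that survives the sieve, whereas by orthogonality the
mean of \<open>F\<^sup>2\<close> is only about \<open>G\<close>.  Comparing the sum of \<open>F\<^sup>2\<close> over the survivors
with that over the whole residue class gives the proportion \<open>1/G\<close>.  This is Selberg's choice of
weights, read off from the diagonalised quadratic form.\<close>

lemma selberg_upper_bound:
  fixes P :: "nat set" and k q a N :: nat and D :: real
  assumes fin: "finite P" and q: "q > 0" and D: "D \<ge> 1"
    and pr: "\<And>l. l \<in> P \<Longrightarrow> prime l \<and> 2 < l \<and> \<not> l dvd k \<and> \<not> l dvd q"
  shows "real (card {n \<in> {1..N}. [n = a] (mod q) \<and> (\<forall>l\<in>P. \<not> l dvd n * (n + k))})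
           \<le> real N / (real q * sieve_mass P D) + D ^ 4"
proof -
  define G where "G = sieve_mass P D"
  define S where "S = sieve_support P D"
  define A where "A = {n. n \<in> {1..N} \<and> [n = a] (mod q)}"
  define B where "B = {n \<in> {1..N}. [n = a] (mod q) \<and> (\<forall>l\<in>P. \<not> l dvd n * (n + k))}"
  define F where "F n = (\<Sum>W\<in>S. sieve_weight W * centred k W n)" for n
  have fS: "finite S" unfolding S_def by (rule finite_sieve_support[OF fin])
  have SP: "W \<subseteq> P" "finite W" "real (\<Prod>W) \<le> D" if "W \<in> S" for W
    using that fin by (auto simp: S_def sieve_support_def intro: finite_subset)
  have pos: "sieve_weight W > 0" if "W \<in> S" for W
    using pr SP[OF that] by (intro sieve_weight_pos) blast
  have G1: "G \<ge> 1" unfolding G_def using fin pr D by (intro sieve_mass_ge_1) auto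
  have FB: "F n = G" if "n \<in> B" for n
  proof -
    have "centred k W n = 1" if "W \<in> S" for W
      unfolding centred_def using \<open>n \<in> B\<close> SP[OF that] by (intro prod.neutral) (auto simp: B_def)
    then show ?thesis by (simp add: F_def G_def sieve_mass_def S_def)
  qed
  have "real (card B) * G\<^sup>2 = (\<Sum>n\<in>B. (F n)\<^sup>2)" by (simp add: FB)
  also have "\<dots> \<le> (\<Sum>n\<in>A. (F n)\<^sup>2)"
    by (intro sum_mono2) (auto simp: A_def B_def)
  also have "\<dots> = (\<Sum>n\<in>A. \<Sum>W\<in>S. \<Sum>V\<in>S. sieve_weight W * sieve_weight V * (centred k W n * centred k V n))"
    by (simp add: F_def power2_eq_square sum_product mult_ac)
  also have "\<dots> = (\<Sum>W\<in>S. \<Sum>V\<in>S. \<Sum>n\<in>A. sieve_weight W * sieve_weight V * (centred k W n * centred k V n))"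
    by (subst sum.swap) (intro sum.cong refl sum.swap)
  also have "\<dots> = (\<Sum>W\<in>S. \<Sum>V\<in>S. sieve_weight W * sieve_weight V * (\<Sum>n\<in>A. centred k W n * centred k V n))"
    by (simp add: sum_distrib_left)
  also have "\<dots> \<le> (\<Sum>W\<in>S. \<Sum>V\<in>S. sieve_weight W * sieve_weight V *
       ((if W = V then real N / (real q * sieve_weight W) else 0) + D ^ 4))"
  proof (intro sum_mono mult_left_mono)
    fix W V assume WV: "W \<in> S" "V \<in> S"
    have "\<And>l. l \<in> W \<union> V \<Longrightarrow> prime l \<and> 2 < l \<and> \<not> l dvd k \<and> \<not> l dvd q"
      using pr SP(1)[OF WV(1)] SP(1)[OF WV(2)] by blast
    then show "(\<Sum>n\<in>A. centred k W n * centred k V n)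
        \<le> (if W = V then real N / (real q * sieve_weight W) else 0) + D ^ 4"
      unfolding A_def using SP WV q by (intro centred_correlation) blast+
    show "0 \<le> sieve_weight W * sieve_weight V"
      using pos[OF WV(1)] pos[OF WV(2)] by simp
  qed
  also have "\<dots> = (\<Sum>W\<in>S. \<Sum>V\<in>S. (if W = V then sieve_weight W * (real N / real q) else 0)
        + D ^ 4 * (sieve_weight W * sieve_weight V))"
    using pos q by (intro sum.cong refl) (force simp: field_simps)
  also have "\<dots> = real N / real q * G + D ^ 4 * G\<^sup>2"
    using fS by (simp add: sum.distrib G_def sieve_mass_def S_def[symmetric] sum_product
       power2_eq_square sum_distrib_left sum_distrib_right sum_divide_distrib mult_ac)
  finally have "real (card B) * G\<^sup>2 \<le> real N / real q * G + D ^ 4 * G\<^sup>2" .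
  then have "real (card B) \<le> (real N / real q * G + D ^ 4 * G\<^sup>2) / G\<^sup>2"
    using G1 by (simp add: pos_le_divide_eq)
  also have "\<dots> = real N / (real q * G) + D ^ 4"
    using G1 by (simp add: field_simps power2_eq_square)
  finally show ?thesis by (simp add: B_def G_def)
qed

section \<open>A lower bound for the mass of the sieve weights\<close>

text \<open>This is the sum of \<open>1/n\<close> over all \<open>n\<close> whose set of prime factors is \<open>W\<close>; it
links the sieve weights with the harmonic series.\<close>

definition euler_weight :: "nat set \<Rightarrow> real" where
  "euler_weight W = (\<Prod>l\<in>W. 1 / (real l - 1))"

text \<open>Splitting off the power of one prime \<open>l\<close> at a time leaves a geometric series with sum
\<open>1/(l - 1)\<close>.\<close>

lemma sum_reciprocals_given_primes:
  assumes "finite W" "finite B" "\<And>l. l \<in> W \<Longrightarrow> prime l"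
    and "\<And>n. n \<in> B \<Longrightarrow> n > 0 \<and> prime_factors n = W"
  shows "(\<Sum>n\<in>B. 1 / real n) \<le> euler_weight W"
  using assms
proof (induction W arbitrary: B rule: finite_induct)
  case empty
  have "B \<subseteq> {1}"
  proof
    fix n assume "n \<in> B"
    then have "n > 0" "prime_factorization n = {#}" using empty by auto
    then show "n \<in> {1}" by (simp add: prime_factorization_empty_iff)
  qed
  then have "(\<Sum>n\<in>B. 1 / real n) \<le> (\<Sum>n\<in>{1}. 1 / real n)"
    by (intro sum_mono2) auto
  then show ?case by (simp add: euler_weight_def)
next
  case (insert l W)
  show ?case
  proof -
    have l: "prime l" using insert.prems by auto
    define e where "e n = multiplicity l n" for n :: nat
    define m where "m n = n div l ^ e n" for n
    define E where "E = Max (e ` B)"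
    have n_eq: "n = l ^ e n * m n" for n
      unfolding m_def e_def by (simp add: multiplicity_dvd)
    have e1: "e n \<in> {1..E}" if "n \<in> B" for n
    proof -
      have "l dvd n" "n > 0" using insert.prems(3)[OF that] by auto
      then have "e n \<ge> 1" unfolding e_def
        using l by (metis One_nat_def Suc_leI not_prime_unit prime_multiplicity_gt_zero_iff prime_imp_prime_elem neq0_conv)
      then show ?thesis using insert.prems(1) that by (simp add: E_def)
    qed
    have m1: "m n > 0 \<and> prime_factors (m n) = W" if "n \<in> B" for n
    proof -
      have n: "n > 0" "prime_factors n = insert l W" using insert.prems(3)[OF that] by auto
      have m0: "m n > 0" using n_eq[of n] n by (metis mult_0_right neq0_conv)
      have "\<not> l dvd m n"
        unfolding m_def e_def using n l
        by (metis multiplicity_decompose not_prime_unit neq0_conv)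
      moreover have "prime_factors n = insert l (prime_factors (m n))"
      proof -
        have "prime_factors n = prime_factors (l ^ e n) \<union> prime_factors (m n)"
          using n_eq[of n] m0 l by (metis prime_factors_product power_not_zero not_prime_0 neq0_conv)
        also have "prime_factors (l ^ e n) = {l}"
          using l e1[OF that] by (auto simp: prime_factors_power prime_prime_factors)
        finally show ?thesis by simp
      qed
      ultimately show ?thesis using n m0 insert.hyps by (auto dest: in_prime_factors_imp_dvd)
    qed
    have inj: "inj_on (\<lambda>n. (e n, m n)) B"
      by (rule inj_onI) (metis n_eq prod.inject)
    have geom: "(\<Sum>i=1..E. 1 / real l ^ i) \<le> 1 / (real l - 1)"
    proof -
      have l2: "real l \<ge> 2" using l prime_ge_2_nat by force
      have "(real l - 1) * (\<Sum>i=1..E. 1 / real l ^ i) = 1 - 1 / real l ^ E"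
        using l2 by (induction E) (auto simp: field_simps)
      also have "\<dots> \<le> 1" by simp
      finally show ?thesis using l2 by (simp add: field_simps)
    qed
    have "(\<Sum>n\<in>B. 1 / real n) = (\<Sum>n\<in>B. (1 / real l ^ e n) * (1 / real (m n)))"
      by (intro sum.cong refl) (subst n_eq, simp)
    also have "\<dots> = (\<Sum>(i,j)\<in>(\<lambda>n. (e n, m n)) ` B. (1 / real l ^ i) * (1 / real j))"
      by (subst sum.reindex[OF inj]) simp
    also have "\<dots> \<le> (\<Sum>(i,j)\<in>{1..E} \<times> m ` B. (1 / real l ^ i) * (1 / real j))"
      using e1 insert.prems(1) by (intro sum_mono2) auto
    also have "\<dots> = (\<Sum>i=1..E. 1 / real l ^ i) * (\<Sum>j\<in>m ` B. 1 / real j)"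
      by (simp add: sum_product sum.cartesian_product)
    also have "\<dots> \<le> (1 / (real l - 1)) * euler_weight W"
    proof (intro mult_mono geom)
      show "(\<Sum>j\<in>m ` B. 1 / real j) \<le> euler_weight W"
        using insert.prems m1 by (intro insert.IH) auto
      show "0 \<le> 1 / (real l - 1)" using prime_ge_2_nat[OF l] by simp
    qed (auto intro: sum_nonneg)
    also have "\<dots> = euler_weight (insert l W)"
      using insert.hyps by (simp add: euler_weight_def)
    finally show ?thesis .
  qed
qed

lemma prod_primes_dvd_iff:
  fixes n :: nat
  assumes "finite W" "\<And>q. q \<in> W \<Longrightarrow> prime q"
  shows "\<Prod>W dvd n \<longleftrightarrow> (\<forall>q\<in>W. q dvd n)"
  using assms
proof (induction W rule: finite_induct)
  case (insert q W)
  have "coprime q (\<Prod>W)"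
    using insert by (intro prod_coprime_right) (metis insertCI primes_coprime)
  then show ?case using insert
    by (auto intro: divides_mult dvd_mult_left dvd_mult_right)
qed auto

text \<open>Grouping \<open>n \<le> Y\<close> by its set of prime factors, whose product is again at most \<open>Y\<close>.\<close>

lemma harm_le_euler_mass:
  assumes "finite P" "{p. prime p \<and> p \<le> Y} \<subseteq> P" "\<And>p. p \<in> P \<Longrightarrow> prime p"
  shows "harm Y \<le> (\<Sum>W\<in>sieve_support P (real Y). euler_weight W)"
proof -
  have "harm Y = (\<Sum>n\<in>{1..Y}. 1 / real n)" by (simp add: harm_def inverse_eq_divide)
  also have "\<dots> = (\<Sum>W\<in>sieve_support P (real Y). \<Sum>n\<in>{n\<in>{1..Y}. prime_factors n = W}. 1 / real n)"
  proof (rule sum.group[symmetric])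
    show "prime_factors ` {1..Y} \<subseteq> sieve_support P (real Y)"
    proof safe
      fix n assume n: "n \<in> {1..Y}"
      have "\<Prod>(prime_factors n) dvd n"
        by (subst prod_primes_dvd_iff) (auto dest: in_prime_factors_imp_dvd)
      then have le: "\<Prod>(prime_factors n) \<le> Y"
        using n by (auto dest!: dvd_imp_le)
      have "p \<in> P" if "p \<in> prime_factors n" for p
      proof -
        have "p \<le> Y" "prime p"
          using that n in_prime_factors_imp_dvd[OF that] by (auto dest!: dvd_imp_le)
        then show ?thesis using assms(2) by auto
      qed
      then show "prime_factors n \<in> sieve_support P (real Y)"
        using le unfolding sieve_support_def by (auto simp only: of_nat_le_iff)
    qed
  qed (use assms finite_sieve_support in auto)
  also have "\<dots> \<le> (\<Sum>W\<in>sieve_support P (real Y). euler_weight W)"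
    using assms by (intro sum_mono sum_reciprocals_given_primes)
      (auto simp: sieve_support_def intro: finite_subset)
  finally show ?thesis .
qed

lemma sum_Pow_prod:
  fixes f :: "'a \<Rightarrow> real"
  assumes "finite U"
  shows "(\<Sum>X\<in>Pow U. \<Prod>x\<in>X. f x) = (\<Prod>x\<in>U. 1 + f x)"
  using prod_add[OF assms, of f "\<lambda>_. 1"] by (simp add: add.commute)

lemma euler_factor_bounds:
  assumes "prime l"
  shows "1 \<le> 1 + 1 / (real l - 1)" "1 + 1 / (real l - 1) \<le> 2"
proof -
  have "real l \<ge> 2" using prime_ge_2_nat[OF assms] by simp
  then show "1 \<le> 1 + 1 / (real l - 1)" "1 + 1 / (real l - 1) \<le> 2"
    by (simp_all add: field_simps)
qed

lemma euler_weight_nonneg: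
  assumes "\<And>l. l \<in> W \<Longrightarrow> prime l"
  shows "euler_weight W \<ge> 0"
  unfolding euler_weight_def
proof (intro prod_nonneg)
  fix l assume "l \<in> W"
  then have "l \<ge> 1" using assms prime_ge_1_nat by blast
  then show "0 \<le> 1 / (real l - 1)" by simp
qed

text \<open>Restricting the sieve to primes outside \<open>B\<close> costs at most the Euler factors of \<open>B\<close>.  This
keeps the mass large although the primes dividing the modulus and \<open>k\<close> cannot be sieved by.\<close>

lemma euler_mass_remove_primes:
  assumes "finite P" "finite B" "P \<inter> B = {}" "\<And>p. p \<in> P \<union> B \<Longrightarrow> prime p"
  shows "(\<Sum>W\<in>sieve_support (P \<union> B) D. euler_weight W)
     \<le> (\<Prod>l\<in>B. 1 + 1 / (real l - 1)) * (\<Sum>W\<in>sieve_support P D. euler_weight W)"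
proof -
  let ?S = "sieve_support (P \<union> B) D"
  have ge: "real l \<ge> 1" if "l \<in> P \<union> B" for l
    using assms(4)[OF that] prime_ge_1_nat by force
  have fin: "finite W" if "W \<subseteq> P \<union> B" for W
    using that assms finite_subset by blast
  have S: "W \<subseteq> P \<union> B" if "W \<in> ?S" for W using that by (auto simp: sieve_support_def)
  have split: "euler_weight W = euler_weight (W \<inter> B) * euler_weight (W \<inter> P)" if "W \<in> ?S" for W
  proof -
    have "W = (W \<inter> B) \<union> (W \<inter> P)" using S[OF that] by auto
    then show ?thesis unfolding euler_weight_def
      using assms fin[OF S[OF that]] by (subst prod.union_disjoint[symmetric]) auto
  qed
  have inj: "inj_on (\<lambda>W. (W \<inter> B, W \<inter> P)) ?S"
    by (rule inj_onI) (use S in blast)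
  have sub: "(\<lambda>W. (W \<inter> B, W \<inter> P)) ` ?S \<subseteq> Pow B \<times> sieve_support P D"
  proof safe
    fix W assume W: "W \<in> ?S"
    have "\<Prod>(W \<inter> P) \<le> \<Prod>W"
      using fin[OF S[OF W]] assms(4) S[OF W] prime_ge_1_nat
      by (intro dvd_imp_le prod_dvd_prod_subset prod_pos) (auto simp: prime_gt_0_nat subset_iff)
    then have "real (\<Prod>(W \<inter> P)) \<le> real (\<Prod>W)" by (simp only: of_nat_le_iff)
    then show "W \<inter> P \<in> sieve_support P D"
      using W by (auto simp: sieve_support_def simp del: of_nat_prod)
  qed
  have nn: "0 \<le> euler_weight W" if "W \<subseteq> P \<union> B" for W
    using that assms(4) by (intro euler_weight_nonneg) auto
  have "(\<Sum>W\<in>?S. euler_weight W) = (\<Sum>W\<in>?S. euler_weight (W \<inter> B) * euler_weight (W \<inter> P))"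
    using split by (intro sum.cong) auto
  also have "\<dots> = (\<Sum>(X,Y)\<in>(\<lambda>W. (W \<inter> B, W \<inter> P)) ` ?S. euler_weight X * euler_weight Y)"
    by (subst sum.reindex[OF inj]) simp
  also have "\<dots> \<le> (\<Sum>(X,Y)\<in>Pow B \<times> sieve_support P D. euler_weight X * euler_weight Y)"
  proof (intro sum_mono2 sub)
    show "finite (Pow B \<times> sieve_support P D)"
      using assms finite_sieve_support by auto
  qed (auto simp: sieve_support_def intro!: mult_nonneg_nonneg nn)
  also have "\<dots> = (\<Sum>X\<in>Pow B. euler_weight X) * (\<Sum>W\<in>sieve_support P D. euler_weight W)"
    by (simp add: sum_product sum.cartesian_product)
  also have "(\<Sum>X\<in>Pow B. euler_weight X) = (\<Prod>l\<in>B. 1 + 1 / (real l - 1))"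
    unfolding euler_weight_def using assms by (intro sum_Pow_prod)
  finally show ?thesis .
qed

text \<open>An element of \<open>U\<close> lies in \<open>W\<close> only, in \<open>V\<close> only, or in both, which gives the three
terms \<open>f + f + f\<^sup>2\<close>.\<close>

lemma sum_pairs_with_union:
  fixes f :: "'a \<Rightarrow> real"
  assumes "finite U"
  shows "(\<Sum>(W,V) | W \<union> V = U. (\<Prod>x\<in>W. f x) * (\<Prod>x\<in>V. f x)) = (\<Prod>x\<in>U. 2 * f x + (f x)\<^sup>2)"
proof -
  have eq: "{(W,V). W \<union> V = U} = Sigma (Pow U) (\<lambda>W. (\<lambda>C. (U - W) \<union> C) ` Pow W)"
  proof (intro set_eqI iffI; clarsimp)
    fix W V :: "'a set" assume "U = W \<union> V"
    then have "V = (W \<union> V - W) \<union> (V \<inter> W)" by auto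
    then show "V \<in> (\<lambda>C. W \<union> V - W \<union> C) ` Pow W" by blast
  qed auto
  have "(\<Sum>(W,V) | W \<union> V = U. (\<Prod>x\<in>W. f x) * (\<Prod>x\<in>V. f x))
      = (\<Sum>W\<in>Pow U. \<Sum>V\<in>(\<lambda>C. (U - W) \<union> C) ` Pow W. (\<Prod>x\<in>W. f x) * (\<Prod>x\<in>V. f x))"
    unfolding eq using assms by (intro sum.Sigma[symmetric]) (auto intro: finite_subset)
  also have "\<dots> = (\<Sum>W\<in>Pow U. (\<Prod>x\<in>W. f x * (1 + f x)) * (\<Prod>x\<in>U - W. f x))"
  proof (rule sum.cong[OF refl])
    fix W assume W: "W \<in> Pow U"
    then have fW: "finite W" using assms finite_subset by auto
    have "(\<Sum>V\<in>(\<lambda>C. (U - W) \<union> C) ` Pow W. (\<Prod>x\<in>W. f x) * (\<Prod>x\<in>V. f x))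
      = (\<Sum>C\<in>Pow W. (\<Prod>x\<in>W. f x) * (\<Prod>x\<in>(U - W) \<union> C. f x))"
      by (subst sum.reindex) (auto simp: inj_on_def)
    also have "\<dots> = (\<Sum>C\<in>Pow W. (\<Prod>x\<in>W. f x) * (\<Prod>x\<in>U - W. f x) * (\<Prod>x\<in>C. f x))"
    proof (rule sum.cong[OF refl])
      fix C assume "C \<in> Pow W"
      then have "(\<Prod>x\<in>(U - W) \<union> C. f x) = (\<Prod>x\<in>U - W. f x) * (\<Prod>x\<in>C. f x)"
        using assms fW by (intro prod.union_disjoint) (auto intro: finite_subset)
      then show "(\<Prod>x\<in>W. f x) * (\<Prod>x\<in>(U - W) \<union> C. f x)
        = (\<Prod>x\<in>W. f x) * (\<Prod>x\<in>U - W. f x) * (\<Prod>x\<in>C. f x)" by simp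
    qed
    also have "\<dots> = (\<Prod>x\<in>W. f x * (1 + f x)) * (\<Prod>x\<in>U - W. f x)"
      by (simp add: sum_distrib_left[symmetric] sum_Pow_prod[OF fW] prod.distrib)
    finally show "(\<Sum>V\<in>(\<lambda>C. (U - W) \<union> C) ` Pow W. (\<Prod>x\<in>W. f x) * (\<Prod>x\<in>V. f x)) = \<dots>" .
  qed
  also have "\<dots> = (\<Prod>x\<in>U. f x * (1 + f x) + f x)"
    by (rule prod_add[OF assms, symmetric])
  also have "\<dots> = (\<Prod>x\<in>U. 2 * f x + (f x)\<^sup>2)"
    by (intro prod.cong refl) (simp add: algebra_simps power2_eq_square)
  finally show ?thesis .
qed

text \<open>The sieve removes two residue classes per prime, so the mass of its weights should be of the order of the
square of a mass belonging to one class per prime.  Squaring the latter and grouping the pairs by their union gives the local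
factor \<open>(2 l - 1)/(l - 1)\<^sup>2\<close>, which is below \<open>2/(l - 2)\<close>.\<close>

lemma square_euler_mass_le_sieve_mass:
  assumes "finite P" "\<And>p. p \<in> P \<Longrightarrow> prime p \<and> 2 < p" "D \<ge> 0"
  shows "(\<Sum>W\<in>sieve_support P D. euler_weight W)\<^sup>2 \<le> sieve_mass P (D\<^sup>2)"
proof -
  let ?S = "sieve_support P D" and ?S2 = "sieve_support P (D\<^sup>2)"
  let ?f = "\<lambda>l. 1 / (real l - 1)"
  have fin: "finite W" if "W \<subseteq> P" for W using that assms finite_subset by blast
  have nn: "0 \<le> euler_weight W" if "W \<subseteq> P" for W
    using that assms(2) by (intro euler_weight_nonneg) auto
  have un: "(\<lambda>(W,V). W \<union> V) ` (?S \<times> ?S) \<subseteq> ?S2"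
  proof safe
    fix W V assume W: "W \<in> ?S" and V: "V \<in> ?S"
    have sub: "W \<subseteq> P" "V \<subseteq> P" using W V by (auto simp: sieve_support_def)
    have "q dvd \<Prod>X" if "q \<in> X" "X \<subseteq> P" for q X
      using that fin assms(2) prod_primes_dvd_iff[of X "\<Prod>X"] by blast
    then have "\<Prod>(W \<union> V) dvd \<Prod>W * \<Prod>V"
      using sub fin assms(2) by (subst prod_primes_dvd_iff) (auto intro: dvd_mult dvd_mult2)
    moreover have "\<Prod>W * \<Prod>V > 0"
      using sub assms(2) by (auto intro!: prod_pos simp: prime_gt_0_nat subset_iff)
    ultimately have "\<Prod>(W \<union> V) \<le> \<Prod>W * \<Prod>V" by (rule dvd_imp_le)
    then have "real (\<Prod>(W \<union> V)) \<le> real (\<Prod>W) * real (\<Prod>V)"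
      by (simp only: of_nat_le_iff of_nat_mult[symmetric])
    also have "\<dots> \<le> D * D" using W V assms(3)
      by (intro mult_mono) (auto simp: sieve_support_def intro: prod_nonneg)
    finally show "W \<union> V \<in> ?S2"
      using sub by (auto simp: sieve_support_def power2_eq_square simp del: of_nat_prod)
  qed
  have "(\<Sum>W\<in>?S. euler_weight W)\<^sup>2 = (\<Sum>(W,V)\<in>?S \<times> ?S. euler_weight W * euler_weight V)"
    by (simp add: power2_eq_square sum_product sum.cartesian_product)
  also have "\<dots> = (\<Sum>U\<in>?S2. \<Sum>(W,V)\<in>{WV \<in> ?S \<times> ?S. (case WV of (W,V) \<Rightarrow> W \<union> V) = U}.
                     euler_weight W * euler_weight V)"
    using finite_sieve_support[OF assms(1)] un by (intro sum.group[symmetric]) auto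
  also have "\<dots> \<le> (\<Sum>U\<in>?S2. sieve_weight U)"
  proof (rule sum_mono)
    fix U assume "U \<in> ?S2"
    then have U: "U \<subseteq> P" by (auto simp: sieve_support_def)
    have "finite (Pow U \<times> Pow U)" using fin[OF U] by auto
    moreover have sub: "{(W,V). W \<union> V = U} \<subseteq> Pow U \<times> Pow U" by auto
    ultimately have f: "finite {(W,V). W \<union> V = U}" by (rule rev_finite_subset)
    have "(\<Sum>(W,V)\<in>{WV \<in> ?S \<times> ?S. (case WV of (W,V) \<Rightarrow> W \<union> V) = U}. euler_weight W * euler_weight V)
        \<le> (\<Sum>(W,V) | W \<union> V = U. euler_weight W * euler_weight V)"
      using U by (intro sum_mono2 f) (auto intro!: mult_nonneg_nonneg nn)
    also have "\<dots> = (\<Prod>l\<in>U. 2 * ?f l + (?f l)\<^sup>2)"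
      unfolding euler_weight_def by (rule sum_pairs_with_union[OF fin[OF U]])
    also have "\<dots> \<le> sieve_weight U"
      unfolding sieve_weight_def
    proof (intro prod_mono conjI)
      fix l assume "l \<in> U"
      then have "l > 2" using U assms(2) by auto
      then obtain t where t: "real l = t + 1" "t > 1"
        by (intro that[of "real l - 1"]) auto
      show "0 \<le> 2 * ?f l + (?f l)\<^sup>2" using t by simp
      have "2 * ?f l + (?f l)\<^sup>2 = (2 * t + 1) / t\<^sup>2"
        using t by (simp add: field_simps power2_eq_square)
      also have "\<dots> \<le> 2 / (t - 1)"
        using t by (simp add: divide_simps) (simp add: algebra_simps power2_eq_square)
      finally show "2 * ?f l + (?f l)\<^sup>2 \<le> 2 / (real l - 2)" using t by simp
    qed
    finally show "(\<Sum>(W,V)\<in>{WV \<in> ?S \<times> ?S. (case WV of (W,V) \<Rightarrow> W \<union> V) = U}.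
        euler_weight W * euler_weight V) \<le> sieve_weight U" .
  qed
  finally show ?thesis by (simp add: sieve_mass_def)
qed

section \<open>Prime pairs in a residue class: uniform upper bounds\<close>

text \<open>The factor 2 in the denominator bounds the Euler factor of the modulus \<open>r\<close>.  It makes the bound
independent of \<open>r\<close>, as is needed to sum over \<open>r\<close> later.\<close>

lemma sieve_mass_lower_bound:
  fixes k r Y :: nat
  assumes "even k" "k > 0" "prime r" "Y \<ge> 1"
  shows "(ln (real Y + 1) / (2 * (\<Prod>l\<in>prime_factors k. 1 + 1 / (real l - 1))))\<^sup>2
      \<le> sieve_mass {l. prime l \<and> l \<le> Y\<^sup>2 \<and> \<not> l dvd k \<and> l \<noteq> r} ((real Y)\<^sup>2)"
proof -
  define K where "K = (\<Prod>l\<in>prime_factors k. 1 + 1 / (real l - 1))"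
  define P where "P = {l. prime l \<and> l \<le> Y\<^sup>2 \<and> \<not> l dvd k \<and> l \<noteq> r}"
  define B where "B = insert r (prime_factors k)"
  define E where "E = (\<Sum>W\<in>sieve_support P (real Y). euler_weight W)"
  have fin: "finite P" "finite B" by (auto simp: P_def B_def)
  have disj: "P \<inter> B = {}" by (auto simp: P_def B_def)
  have prB: "prime p" if "p \<in> B" for p using that assms by (auto simp: B_def)
  have pr: "prime p" if "p \<in> P \<union> B" for p
    using that prB by (auto simp: P_def)
  have gt2: "2 < p" if "p \<in> P" for p
    using that assms(1) prime_ge_2_nat[of p] by (cases "p = 2") (auto simp: P_def)
  have K1: "K \<ge> 1" unfolding K_def by (intro prod_ge_1 euler_factor_bounds(1)) auto
  have "(\<Prod>l\<in>B. 1 + 1 / (real l - 1)) \<le> 2 * K"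
  proof (cases "r \<in> prime_factors k")
    case True
    then show ?thesis using K1 by (simp add: B_def K_def insert_absorb)
  next
    case False
    then have "(\<Prod>l\<in>B. 1 + 1 / (real l - 1)) = (1 + 1 / (real r - 1)) * K"
      by (simp add: B_def K_def)
    also have "\<dots> \<le> 2 * K" using euler_factor_bounds(2)[OF assms(3)] K1 by (intro mult_right_mono) auto
    finally show ?thesis .
  qed
  moreover have E0: "E \<ge> 0" unfolding E_def using pr
    by (intro sum_nonneg euler_weight_nonneg) (auto simp: sieve_support_def)
  ultimately have KE: "(\<Prod>l\<in>B. 1 + 1 / (real l - 1)) * E \<le> 2 * K * E"
    by (intro mult_right_mono)
  have "Y \<le> Y\<^sup>2" using assms(4) by (simp add: power2_eq_square)
  then have cover: "{p. prime p \<and> p \<le> Y} \<subseteq> P \<union> B"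
    using assms(2) by (auto simp: P_def B_def prime_factors_dvd)
  have "ln (real Y + 1) \<le> harm Y" by (rule harm_ge_ln)
  also have "\<dots> \<le> (\<Sum>W\<in>sieve_support (P \<union> B) (real Y). euler_weight W)"
    using fin pr cover by (intro harm_le_euler_mass) auto
  also have "\<dots> \<le> (\<Prod>l\<in>B. 1 + 1 / (real l - 1)) * E"
    unfolding E_def using fin disj pr by (intro euler_mass_remove_primes) auto
  also note KE
  finally have "ln (real Y + 1) / (2 * K) \<le> E"
    using K1 by (simp add: field_simps)
  then have "(ln (real Y + 1) / (2 * K))\<^sup>2 \<le> E\<^sup>2"
    using K1 by (intro power_mono) auto
  also have "\<dots> \<le> sieve_mass P ((real Y)\<^sup>2)"
    unfolding E_def using fin pr gt2 by (intro square_euler_mass_le_sieve_mass) auto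
  finally show ?thesis unfolding K_def P_def .
qed

text \<open>A member \<open>p > Y\<^sup>2\<close> of a prime pair survives the sieve by primes up to \<open>Y\<^sup>2\<close>, since
\<open>p\<close> and \<open>p + k\<close> have no smaller prime factors.  The error \<open>3 Y\<^sup>8\<close> covers that
of the sieve and the \<open>p \<le> Y\<^sup>2\<close>.\<close>

lemma prime_pairs_class_sieve_bound:
  fixes k r a N Y :: nat
  assumes "even k" "k > 0" "prime r" "Y \<ge> 1"
  shows "real (card {p \<in> prime_pairs k. p \<le> N \<and> [p = a] (mod r)})
     \<le> real N / (real r * (ln (real Y + 1) / (2 * (\<Prod>l\<in>prime_factors k. 1 + 1 / (real l - 1))))\<^sup>2)
        + 3 * real Y ^ 8"
proof -
  define L where "L = (ln (real Y + 1) / (2 * (\<Prod>l\<in>prime_factors k. 1 + 1 / (real l - 1))))\<^sup>2"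
  define P where "P = {l. prime l \<and> l \<le> Y\<^sup>2 \<and> \<not> l dvd k \<and> l \<noteq> r}"
  define G where "G = sieve_mass P ((real Y)\<^sup>2)"
  define A where "A = {n \<in> {1..N}. [n = a] (mod r) \<and> (\<forall>l\<in>P. \<not> l dvd n * (n + k))}"
  have r0: "r > 0" using assms by (simp add: prime_gt_0_nat)
  have prP: "prime l \<and> 2 < l \<and> \<not> l dvd k \<and> \<not> l dvd r" if "l \<in> P" for l
    using that assms(1,3) prime_ge_2_nat[of l] primes_dvd_imp_eq[of l r]
    by (cases "l = 2") (auto simp: P_def)
  have LG: "L \<le> G" unfolding L_def G_def P_def by (rule sieve_mass_lower_bound[OF assms])
  have "(\<Prod>l\<in>prime_factors k. 1 + 1 / (real l - 1)) > 0"
    by (intro prod_pos less_le_trans[OF zero_less_one euler_factor_bounds(1)]) auto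
  then have L0: "L > 0" unfolding L_def using assms(4) by (intro zero_less_power divide_pos_pos) auto
  have "{p \<in> prime_pairs k. p \<le> N \<and> [p = a] (mod r)} \<subseteq> A \<union> {1..Y\<^sup>2}"
  proof safe
    fix p assume p: "p \<in> prime_pairs k" "p \<le> N" "[p = a] (mod r)" "p \<notin> {1..Y\<^sup>2}"
    have pp: "prime p" "prime (p + k)" using p by (auto simp: prime_pairs_def)
    have big: "p > Y\<^sup>2" "p \<ge> 1" using p pp prime_ge_1_nat[of p] by auto
    have "\<not> l dvd p * (p + k)" if "l \<in> P" for l
    proof
      assume "l dvd p * (p + k)"
      moreover have "prime l" "l \<le> Y\<^sup>2" using that by (auto simp: P_def)
      ultimately have "l = p \<or> l = p + k"
        using pp by (metis prime_dvd_mult_iff primes_dvd_imp_eq)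
      then show False using big \<open>l \<le> Y\<^sup>2\<close> by auto
    qed
    then show "p \<in> A" using p big by (auto simp: A_def)
  qed
  then have "card {p \<in> prime_pairs k. p \<le> N \<and> [p = a] (mod r)} \<le> card (A \<union> {1..Y\<^sup>2})"
    by (intro card_mono) (auto simp: A_def)
  also have "\<dots> \<le> card A + card {1..Y\<^sup>2}" by (rule card_Un_le)
  finally have "real (card {p \<in> prime_pairs k. p \<le> N \<and> [p = a] (mod r)}) \<le> real (card A) + (real Y)\<^sup>2"
    by (simp flip: of_nat_power of_nat_add)
  also have "real (card A) \<le> real N / (real r * G) + ((real Y)\<^sup>2) ^ 4"
    unfolding A_def G_def
  proof (rule selberg_upper_bound)
    show "1 \<le> (real Y)\<^sup>2" using assms(4) by (intro one_le_power) auto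
    show "finite P" by (simp add: P_def)
  qed (use prP r0 in blast)+
  also have "real N / (real r * G) \<le> real N / (real r * L)"
    using LG L0 r0 by (intro divide_left_mono mult_left_mono mult_pos_pos) auto
  also have "((real Y)\<^sup>2) ^ 4 = real Y ^ 8" by (simp flip: power_mult)
  also have "(real Y)\<^sup>2 \<le> real Y ^ 8" using assms(4) by (intro power_increasing) auto
  finally show ?thesis using zero_le_power[of "real Y" 8] unfolding L_def by linarith
qed

text \<open>For \<open>r \<le> x powr (1/4)\<close> the sieve with \<open>Y\<close> near \<open>x powr (1/32)\<close> gives
\<open>x / (r (ln x)\<^sup>2)\<close>.  For larger \<open>r\<close> only the trivial bound \<open>x/r + 1\<close> is
used, and half of the power of \<open>r\<close> is traded for the two missing logarithms; hence the square root.\<close>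

lemma prime_pairs_class_uniform_bound:
  fixes k :: nat
  assumes "even k" "k > 0"
  obtains C where "C > 0" "eventually (\<lambda>x. \<forall>r a. prime r \<longrightarrow> real r \<le> 2 * x \<longrightarrow>
     real (card {p \<in> prime_pairs k. real p \<le> x \<and> [p = a] (mod r)}) \<le> C * (x / (ln x)\<^sup>2) / sqrt (real r)) at_top"
proof -
  define K where "K = (\<Prod>l\<in>prime_factors k. 1 + 1 / (real l - 1))"
  define C where "C = (64 * K)\<^sup>2 + 4"
  have ev1: "eventually (\<lambda>x::real. 3 * x powr (1/4) \<le> x powr (3/4) / (ln x)\<^sup>2) at_top"
    by real_asymp
  have ev2: "eventually (\<lambda>x::real. 3 * (ln x)\<^sup>2 \<le> 4 * x powr (1/8)) at_top"
    by real_asymp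
  have "K > 0" unfolding K_def
    by (intro prod_pos less_le_trans[OF zero_less_one euler_factor_bounds(1)]) auto
  have "eventually (\<lambda>x. \<forall>r a. prime r \<longrightarrow> real r \<le> 2 * x \<longrightarrow>
     real (card {p \<in> prime_pairs k. real p \<le> x \<and> [p = a] (mod r)}) \<le> C * (x / (ln x)\<^sup>2) / sqrt (real r)) at_top"
    using ev1 ev2 eventually_ge_at_top[of "3::real"]
  proof eventually_elim
    case (elim x)
    show ?case
    proof (intro allI impI)
      fix r a :: nat assume r: "prime r" "real r \<le> 2 * x"
      define N where "N = nat \<lfloor>x\<rfloor>"
      have N: "real N \<le> x" using elim by (simp add: N_def)
      have eqN: "{p \<in> prime_pairs k. real p \<le> x \<and> [p = a] (mod r)}
               = {p \<in> prime_pairs k. p \<le> N \<and> [p = a] (mod r)}"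
        using elim by (auto simp: N_def le_nat_floor le_nat_iff le_floor_iff)
      have r1: "real r \<ge> 1" using prime_ge_1_nat[OF r(1)] by simp
      have sr: "sqrt (real r) \<le> real r"
        using r1 by (intro real_le_lsqrt) (auto simp: power2_eq_square)
      have srsr: "sqrt (real r) * sqrt (real r) = real r" by simp
      have sr0: "sqrt (real r) > 0" using r1 by simp
      have lx: "ln x > 0" using elim by simp
      show "real (card {p \<in> prime_pairs k. real p \<le> x \<and> [p = a] (mod r)}) \<le> C * (x / (ln x)\<^sup>2) / sqrt (real r)"
      proof (cases "real r \<le> x powr (1/4)")
        case True
        define Y where "Y = nat \<lfloor>x powr (1/32)\<rfloor>"
        have xp: "x powr (1/32) \<ge> 1" using elim by (intro ge_one_powr_ge_zero) auto
        then have Y: "Y \<ge> 1" "real Y \<le> x powr (1/32)" "x powr (1/32) \<le> real Y + 1"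
          by (auto simp: Y_def le_nat_floor)
        have "real Y ^ 8 \<le> (x powr (1/32)) ^ 8" using Y by (intro power_mono) auto
        also have "\<dots> = x powr (1/4)"
          using elim by (simp add: powr_power)
        finally have Y8: "3 * real Y ^ 8 \<le> x powr (3/4) / (ln x)\<^sup>2" using elim by linarith
        have "x powr (3/4) * real r \<le> x powr (3/4) * x powr (1/4)"
          using True by (intro mult_left_mono) auto
        also have "\<dots> = x" using elim by (simp flip: powr_add)
        finally have "x powr (3/4) \<le> x / real r" using r1 by (simp add: field_simps)
        then have "x powr (3/4) / (ln x)\<^sup>2 \<le> x / real r / (ln x)\<^sup>2"
          by (intro divide_right_mono) auto
        with Y8 have err: "3 * real Y ^ 8 \<le> x / (real r * (ln x)\<^sup>2)" by simp
        have "ln (x powr (1/32)) \<le> ln (real Y + 1)"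
          using Y xp by (subst ln_le_cancel_iff) auto
        then have lY: "ln x / 32 \<le> ln (real Y + 1)" using elim by (simp add: ln_powr)
        have "(ln x / (64 * K))\<^sup>2 = (ln x / 32 / (2 * K))\<^sup>2" by simp
        also have "\<dots> \<le> (ln (real Y + 1) / (2 * K))\<^sup>2"
          using lY lx \<open>K > 0\<close> by (intro power_mono divide_right_mono) auto
        finally have sq: "(ln x / (64 * K))\<^sup>2 \<le> (ln (real Y + 1) / (2 * K))\<^sup>2" .
        have sq0: "(ln x / (64 * K))\<^sup>2 > 0" using lx \<open>K > 0\<close> by simp
        have "real (card {p \<in> prime_pairs k. p \<le> N \<and> [p = a] (mod r)})
           \<le> real N / (real r * (ln (real Y + 1) / (2 * K))\<^sup>2) + 3 * real Y ^ 8"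
          unfolding K_def by (rule prime_pairs_class_sieve_bound[OF assms r(1) Y(1)])
        also have "real N / (real r * (ln (real Y + 1) / (2 * K))\<^sup>2) \<le> x / (real r * (ln x / (64 * K))\<^sup>2)"
          using N sq sq0 r1 by (intro frac_le mult_left_mono mult_pos_pos) auto
        also have "x / (real r * (ln x / (64 * K))\<^sup>2) = (64 * K)\<^sup>2 * (x / (real r * (ln x)\<^sup>2))"
          using \<open>K > 0\<close> lx r1 by (simp add: field_simps power2_eq_square)
        also note err
        also have "(64 * K)\<^sup>2 * (x / (real r * (ln x)\<^sup>2)) + x / (real r * (ln x)\<^sup>2)
            = ((64 * K)\<^sup>2 + 1) * (x / (ln x)\<^sup>2) / real r"
          by (simp add: add_divide_distrib ring_distribs mult.commute[of "real r"])
        also have "\<dots> \<le> C * (x / (ln x)\<^sup>2) / sqrt (real r)"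
          using sr sr0 elim unfolding C_def by (intro frac_le mult_right_mono) auto
        finally show ?thesis unfolding eqN by simp
      next
        case False
        have "\<bar>real (card {n\<in>{1..N}. [n = a] (mod r)}) - real N / real r\<bar> \<le> 1"
          using prime_gt_0_nat[OF r(1)] by (rule card_residue_class_approx)
        moreover have "card {p \<in> prime_pairs k. p \<le> N \<and> [p = a] (mod r)}
            \<le> card {n\<in>{1..N}. [n = a] (mod r)}"
          by (intro card_mono) (auto simp: prime_pairs_def dest: prime_ge_1_nat)
        ultimately have "real (card {p \<in> prime_pairs k. p \<le> N \<and> [p = a] (mod r)}) \<le> real N / real r + 1"
          by linarith
        also have "\<dots> \<le> x / real r + 2 * x / real r"
          using N r r1 by (intro add_mono divide_right_mono) auto
        also have "\<dots> = 3 * x / (sqrt (real r) * sqrt (real r))" by (simp add: srsr)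
        \<comment> \<open>One of the two factors \<open>\<surd>r\<close> is at least \<open>x powr (1/8)\<close>, which outweighs \<open>(ln x)\<^sup>2\<close>.\<close>
        also have "\<dots> \<le> 3 * x / (sqrt (real r) * x powr (1/8))"
        proof -
          have "x powr (1/8) = sqrt (x powr (1/4))"
            using elim by (simp add: powr_powr flip: powr_half_sqrt)
          also have "\<dots> \<le> sqrt (real r)" using False by simp
          finally show ?thesis using sr0 elim by (intro divide_left_mono mult_left_mono mult_pos_pos) auto
        qed
        also have "\<dots> = 3 / x powr (1/8) * (x / sqrt (real r))" by simp
        also have "\<dots> \<le> C / (ln x)\<^sup>2 * (x / sqrt (real r))"
        proof (intro mult_right_mono)
          have "3 / x powr (1/8) \<le> 4 / (ln x)\<^sup>2" using elim lx by (simp add: field_simps)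
          also have "\<dots> \<le> C / (ln x)\<^sup>2" unfolding C_def by (intro divide_right_mono) auto
          finally show "3 / x powr (1/8) \<le> C / (ln x)\<^sup>2" .
        qed (use elim in auto)
        also have "\<dots> = C * (x / (ln x)\<^sup>2) / sqrt (real r)" by simp
        finally show ?thesis unfolding eqN .
      qed
    qed
  qed
  moreover have "C > 0" unfolding C_def by (simp add: add_nonneg_pos)
  ultimately show thesis using that by blast
qed

section \<open>Prime pairs in a residue class: the Bateman--Horn asymptotics\<close>

abbreviation pair_roots :: "nat \<Rightarrow> nat \<Rightarrow> nat" where
  "pair_roots k p \<equiv> num_roots_mod [:0, int k, 1:] p"

lemma pair_roots_eq_card: "pair_roots k p = card {a\<in>{0..<p}. p dvd a * (a + k)}"
proof -
  have "int p dvd poly [:0, int k, 1:] (int a) \<longleftrightarrow> p dvd a * (a + k)" for a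
  proof -
    have "poly [:0, int k, 1:] (int a) = int (a * (a + k))" by (simp add: algebra_simps)
    then show ?thesis by (simp only: int_dvd_int_iff)
  qed
  then show ?thesis by (simp add: num_roots_mod_def)
qed

lemma pair_roots_prime:
  assumes "prime p"
  shows "pair_roots k p = (if p dvd k then 1 else 2)"
proof -
  have p0: "p > 0" using assms by (simp add: prime_gt_0_nat)
  define b where "b = (k * (p - 1)) mod p"
  have b: "p dvd a + k \<longleftrightarrow> a = b" if "a < p" for a
  proof -
    have "p dvd a + k \<longleftrightarrow> [a + k = k * (p - 1) + k] (mod p)"
    proof -
      have "k * (p - 1) + k = k * p" using p0 by (cases p) auto
      then show ?thesis by (simp add: cong_def dvd_eq_mod_eq_0)
    qed
    also have "\<dots> \<longleftrightarrow> [a = k * (p - 1)] (mod p)" by (simp add: cong_add_rcancel_nat)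
    also have "\<dots> \<longleftrightarrow> a = b" using that by (simp add: cong_def b_def)
    finally show ?thesis .
  qed
  have bp: "b < p" using p0 by (simp add: b_def)
  have roots: "{a\<in>{0..<p}. p dvd a * (a + k)} = {0, b}"
  proof (intro set_eqI)
    fix a
    have "p dvd a * (a + k) \<longleftrightarrow> p dvd a \<or> p dvd a + k"
      using assms by (rule prime_dvd_mult_iff)
    moreover have "p dvd a \<longleftrightarrow> a = 0" if "a < p"
      using that by (metis dvd_0_right mod_less mod_0_imp_dvd dvd_imp_mod_0)
    ultimately show "a \<in> {a\<in>{0..<p}. p dvd a * (a + k)} \<longleftrightarrow> a \<in> {0, b}"
      using b[of a] bp p0 by (cases "a < p") simp_all
  qed
  have "b = 0 \<longleftrightarrow> p dvd k" using b[of 0] p0 by auto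
  moreover have "pair_roots k p = card {0, b}" by (simp only: pair_roots_eq_card roots)
  ultimately show ?thesis by (simp add: card_insert_if)
qed

lemma pair_roots_less:
  assumes "prime p" "even k"
  shows "pair_roots k p < p"
  using prime_ge_2_nat[OF assms(1)] assms pair_roots_prime[OF assms(1), of k]
  by (cases "p = 2") auto

text \<open>Prime values of these two polynomials are the prime pairs in the class of \<open>c\<close> modulo \<open>M\<close>.\<close>

definition pair_polys :: "nat \<Rightarrow> nat \<Rightarrow> nat \<Rightarrow> int poly set" where
  "pair_polys k M c = {[:int c, int M:], [:int c + int k, int M:]}"

lemma poly_prod_pair_polys:
  assumes "k > 0"
  shows "poly (\<Prod>(pair_polys k M c)) (int n) = int ((c + M * n) * (c + M * n + k))"
  using assms by (simp add: pair_polys_def algebra_simps)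

text \<open>Modulo a prime not dividing \<open>M\<close> the substitution \<open>n \<mapsto> c + M n\<close> permutes the residues, so the
number of roots is that of \<open>t (t + k)\<close>; modulo a prime dividing \<open>M\<close> the product of the two
polynomials is the nonzero constant \<open>c (c + k)\<close>.\<close>

lemma num_roots_pair_polys:
  assumes "k > 0" "prime p" "coprime (c * (c + k)) M"
  shows "num_roots_mod (\<Prod>(pair_polys k M c)) p = (if p dvd M then 0 else pair_roots k p)"
proof -
  have p0: "p > 0" using assms by (simp add: prime_gt_0_nat)
  have eq: "num_roots_mod (\<Prod>(pair_polys k M c)) p
      = card {a\<in>{0..<p}. p dvd (c + M * a) * (c + M * a + k)}"
    unfolding num_roots_mod_def by (simp only: poly_prod_pair_polys[OF assms(1)] int_dvd_int_iff)
  show ?thesis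
  proof (cases "p dvd M")
    case True
    have "\<not> p dvd (c + M * a) * (c + M * a + k)" for a
    proof
      assume "p dvd (c + M * a) * (c + M * a + k)"
      moreover have "[(c + M * a) * (c + M * a + k) = (c + 0) * (c + 0 + k)] (mod p)"
        using True by (intro cong_mult cong_add cong_refl) (auto simp: cong_0_iff)
      ultimately have "p dvd c * (c + k)" by (simp add: cong_dvd_iff)
      then show False using assms True by (metis coprime_common_divisor not_prime_unit)
    qed
    then show ?thesis using True eq by simp
  next
    case False
    define g where "g a = (c + M * a) mod p" for a
    have cop: "coprime M p"
      by (metis assms(2) False prime_imp_coprime coprime_commute)
    have inj: "inj_on g {0..<p}"
    proof (rule inj_onI)
      fix a b assume ab: "a \<in> {0..<p}" "b \<in> {0..<p}" "g a = g b"
      then have "[c + M * a = c + M * b] (mod p)" by (simp add: g_def cong_def)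
      then have "[a = b] (mod p)" using cop by (simp add: cong_add_lcancel_nat cong_mult_lcancel_nat)
      then show "a = b" using ab by (simp add: cong_def)
    qed
    have img: "g ` {0..<p} = {0..<p}"
      using inj p0 by (intro endo_inj_surj) (auto simp: g_def)
    have gd: "p dvd g a * (g a + k) \<longleftrightarrow> p dvd (c + M * a) * (c + M * a + k)" for a
    proof (rule cong_dvd_iff)
      show "[g a * (g a + k) = (c + M * a) * (c + M * a + k)] (mod p)"
        unfolding g_def by (intro cong_mult cong_add cong_refl) auto
    qed
    have "{b\<in>{0..<p}. p dvd b * (b + k)} = g ` {a\<in>{0..<p}. p dvd (c + M * a) * (c + M * a + k)}"
    proof (intro set_eqI iffI)
      fix b assume b: "b \<in> {b\<in>{0..<p}. p dvd b * (b + k)}"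
      then obtain a where "a \<in> {0..<p}" "b = g a" using img by blast
      then show "b \<in> g ` {a\<in>{0..<p}. p dvd (c + M * a) * (c + M * a + k)}" using b gd by auto
    next
      fix b assume "b \<in> g ` {a\<in>{0..<p}. p dvd (c + M * a) * (c + M * a + k)}"
      then show "b \<in> {b\<in>{0..<p}. p dvd b * (b + k)}" using gd img by blast
    qed
    moreover have "inj_on g {a\<in>{0..<p}. p dvd (c + M * a) * (c + M * a + k)}"
      using inj by (rule inj_on_subset) auto
    ultimately have "pair_roots k p = card {a\<in>{0..<p}. p dvd (c + M * a) * (c + M * a + k)}"
      by (simp only: pair_roots_eq_card card_image)
    then show ?thesis using False eq by simp
  qed
qed

lemma card_pair_polys: "k > 0 \<Longrightarrow> card (pair_polys k M c) = 2"
  by (simp add: pair_polys_def)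

lemma bh_admissible_pair_polys:
  assumes "k > 0" "even k" "M > 0" "coprime (c * (c + k)) M"
  shows "bh_admissible (pair_polys k M c)"
  unfolding bh_admissible_def
proof (intro conjI allI impI ballI)
  have cop: "coprime (int c) (int M)" "coprime (int c + int k) (int M)"
    using assms(4) by (auto simp flip: of_nat_add)
  fix f assume "f \<in> pair_polys k M c"
  then show "irreducible f" "lead_coeff f > 0"
    using cop assms(3) by (auto simp: pair_polys_def intro!: irreducible_linear_poly)
next
  fix p :: nat assume p: "prime p"
  have "num_roots_mod (\<Prod>(pair_polys k M c)) p < p"
    using num_roots_pair_polys[OF assms(1) p assms(4)] pair_roots_less[OF p assms(2)] prime_gt_0_nat[OF p]
    by auto
  then have "{a\<in>{0..<p}. int p dvd poly (\<Prod>(pair_polys k M c)) (int a)} \<noteq> {0..<p}"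
    unfolding num_roots_mod_def by (metis card_atLeastLessThan diff_zero less_irrefl)
  then show "\<exists>n::int. \<not> int p dvd poly (\<Prod>(pair_polys k M c)) n" by blast
qed (auto simp: pair_polys_def)

text \<open>The local factor of the Bateman--Horn constant of \<open>t (t + k)\<close>, continued by 1 to all natural
numbers so that the theory of infinite products applies.\<close>

definition pair_factor :: "nat \<Rightarrow> nat \<Rightarrow> real" where
  "pair_factor k n = (if prime n then (1 - real (pair_roots k n) / real n) / (1 - 1 / real n)\<^sup>2 else 1)"

lemma pair_factor_pos:
  assumes "even k"
  shows "pair_factor k n > 0"
proof (cases "prime n")
  case True
  then show ?thesis
    using pair_roots_less[OF True assms] prime_gt_1_nat[OF True] by (simp add: pair_factor_def)
qed (simp add: pair_factor_def)

text \<open>At all primes beyond \<open>k\<close> the factor is \<open>1 - 1/(n - 1)\<^sup>2\<close>.\<close>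

lemma convergent_prod_pair_factor:
  assumes "k > 0"
  shows "convergent_prod (pair_factor k)"
proof -
  have "summable (\<lambda>n. norm (pair_factor k n - 1))"
  proof (rule summable_comparison_test_ev)
    show "\<forall>\<^sub>F n in sequentially. norm (norm (pair_factor k n - 1)) \<le> 4 * inverse ((real n)\<^sup>2)"
      using eventually_gt_at_top[of k] eventually_gt_at_top[of 1]
    proof eventually_elim
      case (elim n)
      show ?case
      proof (cases "prime n")
        case True
        have "\<not> n dvd k" using elim assms by (auto dest: dvd_imp_le)
        then have nu: "pair_roots k n = 2" using pair_roots_prime[OF True] by simp
        define t where "t = real n"
        have t: "t \<ge> 2" using elim by (simp add: t_def)
        have "pair_factor k n - 1 = (1 - 2 / t) / (1 - 1 / t)\<^sup>2 - 1"
          using True nu by (simp add: pair_factor_def t_def)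
        also have "\<dots> = - (1 / (t - 1)\<^sup>2)"
          using t by (simp add: divide_simps power2_eq_square) (simp add: algebra_simps)
        finally have "norm (pair_factor k n - 1) = 1 / (t - 1)\<^sup>2" by simp
        also have "\<dots> \<le> 1 / (t / 2)\<^sup>2"
          using t by (intro divide_left_mono power_mono mult_pos_pos zero_less_power) auto
        also have "\<dots> = 4 * inverse (t\<^sup>2)" by (simp add: field_simps)
        finally show ?thesis by (simp add: t_def)
      qed (simp add: pair_factor_def)
    qed
    show "summable (\<lambda>n. 4 * inverse ((real n)\<^sup>2))"
      using inverse_power_summable[of 2] by (intro summable_mult) auto
  qed
  then show ?thesis
    by (intro abs_convergent_prod_imp_convergent_prod summable_imp_abs_convergent_prod)
qed

definition pair_const :: "nat \<Rightarrow> real" where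
  "pair_const k = prodinf (pair_factor k)"

lemma pair_const_pos:
  assumes "k > 0" "even k"
  shows "pair_const k > 0"
proof -
  have "pair_factor k n \<noteq> 0" for n
    using pair_factor_pos[OF assms(2), of n] by linarith
  then have "pair_const k \<noteq> 0" unfolding pair_const_def
    using convergent_prod_pair_factor[OF assms(1)] by (intro prodinf_nonzero)
  moreover have "pair_const k \<ge> 0"
    unfolding pair_const_def
    using convergent_prod_LIMSEQ[OF convergent_prod_pair_factor[OF assms(1)]]
    by (rule LIMSEQ_le_const) (auto intro!: exI[of _ 0] prod_nonneg less_imp_le[OF pair_factor_pos[OF assms(2)]])
  ultimately show ?thesis by simp
qed

text \<open>Passing to a residue class only changes the local factors at the primes dividing \<open>M\<close>, from
\<open>1 - N(p)/p\<close> to 1 in the numerator.\<close>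

lemma bh_const_pair_polys:
  assumes "k > 0" "even k" "M > 0" "coprime (c * (c + k)) M"
  shows "bh_const (pair_polys k M c)
       = pair_const k * (\<Prod>p\<in>prime_factors M. real p / (real p - real (pair_roots k p)))"
proof -
  define E where "E = (\<Prod>p\<in>prime_factors M. real p / (real p - real (pair_roots k p)))"
  define h where "h p = (1 - real (num_roots_mod (\<Prod>(pair_polys k M c)) p) / real p)
        / (1 - 1 / real p) ^ card (pair_polys k M c)" for p :: nat
  have partial: "(\<Prod>p | prime p \<and> p \<le> N. h p) = (\<Prod>i\<le>N. pair_factor k i) * E" if "N \<ge> M" for N
  proof -
    have "(\<Prod>p | prime p \<and> p \<le> N. h p)
        = (\<Prod>p | prime p \<and> p \<le> N. pair_factor k p *
             (if p \<in> prime_factors M then real p / (real p - real (pair_roots k p)) else 1))"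
    proof (rule prod.cong[OF refl])
      fix p assume "p \<in> {p. prime p \<and> p \<le> N}"
      then have p: "prime p" by simp
      have "real (pair_roots k p) < real p" "real p > 0"
        using pair_roots_less[OF p assms(2)] prime_gt_0_nat[OF p] by auto
      then show "h p = pair_factor k p *
             (if p \<in> prime_factors M then real p / (real p - real (pair_roots k p)) else 1)"
        using p assms num_roots_pair_polys[OF assms(1) p assms(4)]
        by (auto simp: h_def pair_factor_def card_pair_polys prime_factors_dvd divide_simps)
    qed
    also have "\<dots> = (\<Prod>p | prime p \<and> p \<le> N. pair_factor k p) *
          (\<Prod>p | prime p \<and> p \<le> N. if p \<in> prime_factors M then real p / (real p - real (pair_roots k p)) else 1)"
      by (rule prod.distrib)
    also have "(\<Prod>p | prime p \<and> p \<le> N. pair_factor k p) = (\<Prod>i\<le>N. pair_factor k i)"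
      by (intro prod.mono_neutral_left) (auto simp: pair_factor_def)
    also have "(\<Prod>p | prime p \<and> p \<le> N. if p \<in> prime_factors M then real p / (real p - real (pair_roots k p)) else 1) = E"
      unfolding E_def
    proof (intro prod.mono_neutral_cong_right)
      show "prime_factors M \<subseteq> {p. prime p \<and> p \<le> N}"
        using that assms(3) by (auto simp: in_prime_factors_iff dest!: dvd_imp_le)
    qed auto
    finally show ?thesis .
  qed
  have "(\<lambda>N. (\<Prod>i\<le>N. pair_factor k i) * E) \<longlonglongrightarrow> pair_const k * E"
    unfolding pair_const_def
    by (intro tendsto_mult tendsto_const convergent_prod_LIMSEQ convergent_prod_pair_factor assms)
  then have "(\<lambda>N. \<Prod>p | prime p \<and> p \<le> N. h p) \<longlonglongrightarrow> pair_const k * E"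
    by (rule Lim_transform_eventually)
       (use eventually_ge_at_top[of M] in eventually_elim, simp add: partial)
  then show ?thesis unfolding bh_const_def h_def E_def by (rule limI)
qed

text \<open>By l'Hospital's rule, as the derivative of \<open>x / (ln x)\<^sup>2\<close> is asymptotic to \<open>1 / (ln x)\<^sup>2\<close>.\<close>

lemma integral_inverse_ln_square_asymp:
  "((\<lambda>x::real. integral {2..x} (\<lambda>t. 1 / ln t ^ 2) / (x / (ln x)\<^sup>2)) \<longlongrightarrow> 1) at_top"
proof (rule lhospital_at_top_at_top[where f' = "\<lambda>x. 1 / ln x ^ 2"
      and g' = "\<lambda>x. 1 / ln x ^ 2 - 2 / ln x ^ 3"])
  show "filterlim (\<lambda>x::real. x / (ln x)\<^sup>2) at_top at_top" by real_asymp
  have "eventually (\<lambda>x::real. 1 / ln x ^ 2 - 2 / ln x ^ 3 > 0) at_top" by real_asymp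
  then show "eventually (\<lambda>x::real. 1 / ln x ^ 2 - 2 / ln x ^ 3 \<noteq> 0) at_top"
    by eventually_elim simp
  show "((\<lambda>x::real. (1 / ln x ^ 2) / (1 / ln x ^ 2 - 2 / ln x ^ 3)) \<longlongrightarrow> 1) at_top"
    by real_asymp
  show "\<forall>\<^sub>F x::real in at_top. DERIV (\<lambda>x. integral {2..x} (\<lambda>t. 1 / ln t ^ 2)) x :> 1 / ln x ^ 2"
    using eventually_gt_at_top[of 2]
  proof eventually_elim
    case (elim x)
    have "((\<lambda>x. integral {2..x} (\<lambda>t. 1 / ln t ^ 2)) has_real_derivative 1 / ln x ^ 2)
            (at x within {2..x + 1})"
      using elim by (intro integral_has_real_derivative continuous_intros) auto
    then show ?case using elim by (simp add: at_within_Icc_at)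
  qed
  show "\<forall>\<^sub>F x::real in at_top. DERIV (\<lambda>x. x / (ln x)\<^sup>2) x :> 1 / ln x ^ 2 - 2 / ln x ^ 3"
    using eventually_gt_at_top[of 2]
  proof eventually_elim
    case (elim x)
    then have "ln x > 0" by simp
    then show ?case using elim
      by (auto intro!: derivative_eq_intros simp: field_simps power2_eq_square power3_eq_cube)
  qed
qed

text \<open>The Bateman--Horn conjecture for \<open>pair_polys k M c\<close>, evaluated at \<open>(x - c)/M\<close>.\<close>

lemma prime_pairs_class_asymp:
  assumes BH: "Bateman_Horn_conjecture"
    and k: "k > 0" "even k" and M: "M > 0" "c < M" "coprime (c * (c + k)) M"
  shows "((\<lambda>x::real. real (card {p \<in> prime_pairs k. real p \<le> x \<and> [p = c] (mod M)}) / (x / (ln x)\<^sup>2))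
     \<longlongrightarrow> pair_const k * (\<Prod>p\<in>prime_factors M. real p / (real p - real (pair_roots k p))) / real M) at_top"
proof -
  define F where "F = pair_polys k M c"
  define B where "B = pair_const k * (\<Prod>p\<in>prime_factors M. real p / (real p - real (pair_roots k p)))"
  define I where "I x = integral {2..x} (\<lambda>t::real. 1 / ln t ^ 2)" for x
  have fpos: "real p / (real p - real (pair_roots k p)) > 0" if "p \<in> prime_factors M" for p
  proof -
    have p: "prime p" using that by auto
    show ?thesis using pair_roots_less[OF p k(2)] prime_gt_0_nat[OF p] by simp
  qed
  define Z where "Z x = B * ((x - real c) / real M / (ln ((x - real c) / real M))\<^sup>2)" for x
  have B0: "B > 0" unfolding B_def
    by (intro mult_pos_pos pair_const_pos k prod_pos fpos)
  have deg: "(\<Prod>f\<in>F. degree f) = 1" using M(1) by (intro prod.neutral) (auto simp: F_def pair_polys_def)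
  have "(\<lambda>x. real (bh_count F x)) \<sim>[at_top] (\<lambda>x. B * I x)"
    using BH[unfolded Bateman_Horn_conjecture_def, rule_format, OF bh_admissible_pair_polys[OF k M(1,3)]]
    by (simp add: F_def[symmetric] deg card_pair_polys[OF k(1), of M c, folded F_def] I_def
          B_def bh_const_pair_polys[OF k M(1,3), folded F_def])
  moreover have "(\<lambda>x. B * I x) \<sim>[at_top] (\<lambda>x. B * (x / (ln x)\<^sup>2))"
    unfolding I_def using integral_inverse_ln_square_asymp
    by (intro asymp_equiv_mult asymp_equiv_refl asymp_equivI')
  ultimately have "(\<lambda>x. real (bh_count F x)) \<sim>[at_top] (\<lambda>x. B * (x / (ln x)\<^sup>2))"
    by (rule asymp_equiv_trans)
  then have "((\<lambda>x. real (bh_count F x) / (B * (x / (ln x)\<^sup>2))) \<longlongrightarrow> 1) at_top"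
    by (rule asymp_equivD_strong) (rule eventually_mono[OF eventually_gt_at_top[of 2]], use B0 in auto)
  moreover have lin: "filterlim (\<lambda>x::real. (x - real c) / real M) at_top at_top"
    using M(1) by real_asymp
  ultimately have "((\<lambda>x. real (bh_count F ((x - real c) / real M)) / Z x) \<longlongrightarrow> 1) at_top"
    unfolding Z_def by (rule filterlim_compose)
  moreover have "((\<lambda>x::real. Z x / (x / (ln x)\<^sup>2)) \<longlongrightarrow> B / real M) at_top"
    unfolding divide_inverse[of B "real M"] Z_def using M(1) B0 by real_asymp
  ultimately have "((\<lambda>x. real (bh_count F ((x - real c) / real M)) / Z x * (Z x / (x / (ln x)\<^sup>2)))
      \<longlongrightarrow> 1 * (B / real M)) at_top"
    by (rule tendsto_mult)
  moreover have "eventually (\<lambda>x::real. Z x > 0) at_top"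
    unfolding Z_def using M(1) B0 by real_asymp
  then have "eventually (\<lambda>x. real (bh_count F ((x - real c) / real M)) / Z x * (Z x / (x / (ln x)\<^sup>2))
      = real (bh_count F ((x - real c) / real M)) / (x / (ln x)\<^sup>2)) at_top"
    by eventually_elim simp
  ultimately have lim: "((\<lambda>x. real (bh_count F ((x - real c) / real M)) / (x / (ln x)\<^sup>2))
       \<longlongrightarrow> B / real M) at_top"
    by (auto intro: Lim_transform_eventually)
  \<comment> \<open>The Bateman--Horn count starts at \<open>n = 1\<close> and so misses \<open>p = c\<close>.\<close>
  define e where "e = card {p \<in> prime_pairs k. p = c}"
  have cnt: "card {p \<in> prime_pairs k. real p \<le> x \<and> [p = c] (mod M)}
       = bh_count F ((x - real c) / real M) + e" if "x \<ge> real c" for x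
  proof -
    define S where "S = {n::nat. 0 < n \<and> real n \<le> (x - real c) / real M \<and> (\<forall>f\<in>F. prime (poly f (int n)))}"
    have S: "n \<in> S \<longleftrightarrow> 0 < n \<and> real (c + M * n) \<le> x \<and> c + M * n \<in> prime_pairs k" for n
    proof -
      have "poly [:int c, int M:] (int n) = int (c + M * n)"
           "poly [:int c + int k, int M:] (int n) = int (c + M * n + k)"
        by (simp_all add: algebra_simps)
      then have "(\<forall>f\<in>F. prime (poly f (int n))) \<longleftrightarrow> c + M * n \<in> prime_pairs k"
        by (simp only: F_def pair_polys_def ball_simps prime_nat_int_transfer prime_pairs_def mem_Collect_eq simp_thms)
      then show ?thesis using M(1) by (auto simp: S_def field_simps)
    qed
    have inj: "inj_on (\<lambda>n. c + M * n) S" using M(1) by (auto simp: inj_on_def)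
    have "finite {n. real n \<le> x}" by (rule finite_subset[of _ "{..nat \<lfloor>x\<rfloor>}"]) (auto simp: le_nat_floor)
    then have fin: "finite {p \<in> prime_pairs k. real p \<le> x \<and> [p = c] (mod M)}"
      by (rule rev_finite_subset) auto
    have "{p \<in> prime_pairs k. real p \<le> x \<and> [p = c] (mod M)} = (\<lambda>n. c + M * n) ` S \<union> {p \<in> prime_pairs k. p = c}"
    proof (intro set_eqI iffI)
      fix p assume p: "p \<in> {p \<in> prime_pairs k. real p \<le> x \<and> [p = c] (mod M)}"
      then have "p mod M = c" using M(2) by (simp add: cong_def)
      then have eq: "p = c + M * (p div M)" by (metis add.commute mult_div_mod_eq)
      show "p \<in> (\<lambda>n. c + M * n) ` S \<union> {p \<in> prime_pairs k. p = c}"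
      proof (cases "p div M = 0")
        case True
        then have "p = c" using eq by (metis add_0_right mult_0_right)
        then show ?thesis using p by blast
      next
        case False
        then have "p div M > 0" by (rule neq0_conv[THEN iffD1])
        moreover have "real p \<le> x" "p \<in> prime_pairs k" using p by auto
        ultimately have "p div M \<in> S" unfolding S using eq by metis
        then show ?thesis using eq by blast
      qed
    next
      fix p assume "p \<in> (\<lambda>n. c + M * n) ` S \<union> {p \<in> prime_pairs k. p = c}"
      then consider n where "n \<in> S" "p = c + M * n" | "p \<in> prime_pairs k" "p = c" by blast
      then show "p \<in> {p \<in> prime_pairs k. real p \<le> x \<and> [p = c] (mod M)}"
      proof cases
        case 1
        then show ?thesis unfolding S by (simp add: cong_def)
      next
        case 2
        then show ?thesis using that by simp
      qed
    qed
    moreover have "(\<lambda>n. c + M * n) ` S \<inter> {p \<in> prime_pairs k. p = c} = {}"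
    proof -
      have "c + M * n \<noteq> c" if "n \<in> S" for n
        using that M(1) unfolding S by simp
      then show ?thesis by blast
    qed
    ultimately have "card {p \<in> prime_pairs k. real p \<le> x \<and> [p = c] (mod M)} = card ((\<lambda>n. c + M * n) ` S) + e"
      using fin unfolding e_def by (simp only: card_Un_disjoint finite_Un)
    also have "card ((\<lambda>n. c + M * n) ` S) = bh_count F ((x - real c) / real M)"
      unfolding card_image[OF inj] by (simp only: bh_count_def S_def)
    finally show ?thesis .
  qed
  have "((\<lambda>x::real. real e / (x / (ln x)\<^sup>2)) \<longlongrightarrow> 0) at_top"
    by real_asymp
  from tendsto_add[OF lim this]
  have "((\<lambda>x. real (bh_count F ((x - real c) / real M)) / (x / (ln x)\<^sup>2) + real e / (x / (ln x)\<^sup>2))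
      \<longlongrightarrow> B / real M) at_top" by simp
  then show ?thesis unfolding B_def
    by (rule Lim_transform_eventually)
       (use eventually_ge_at_top[of "real c"] in eventually_elim, simp only: cnt of_nat_add add_divide_distrib)
qed

section \<open>Totients and the residue classes of the two shifts\<close>

definition prime_log :: "nat \<Rightarrow> real" where
  "prime_log r = ln (1 + 1 / (real r - 1))"

lemma prime_log_nonneg:
  assumes "prime r" shows "prime_log r \<ge> 0"
proof -
  have "real r \<ge> 1" using prime_ge_1_nat[OF assms] by simp
  then show ?thesis unfolding prime_log_def by (intro ln_ge_zero) simp
qed

lemma prime_log_le:
  assumes "prime r" shows "prime_log r \<le> 2 / real r"
proof -
  have r: "real r \<ge> 2" using prime_ge_2_nat[OF assms] by simp
  have "prime_log r \<le> 1 / (real r - 1)"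
    unfolding prime_log_def using r by (intro ln_add_one_self_le_self) auto
  also have "\<dots> \<le> 2 / real r" using r by (simp add: field_simps)
  finally show ?thesis .
qed

lemma ln_totient:
  assumes "n > 0"
  shows "ln (real (totient n)) = ln (real n) - (\<Sum>r\<in>prime_factors n. prime_log r)"
proof -
  have pos: "1 - 1 / real r > 0" if "r \<in> prime_factors n" for r
  proof -
    have "prime r" using that by auto
    then have "real r > 1" using prime_gt_1_nat by force
    then show ?thesis by simp
  qed
  have "ln (real (totient n)) = ln (real n) + ln (\<Prod>r\<in>prime_factors n. 1 - 1 / real r)"
    unfolding totient_formula2 using assms pos by (intro ln_mult_pos prod_pos) auto
  also have "ln (\<Prod>r\<in>prime_factors n. 1 - 1 / real r) = (\<Sum>r\<in>prime_factors n. ln (1 - 1 / real r))"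
    by (rule ln_prod) (simp, metis pos less_irrefl)
  also have "\<dots> = (\<Sum>r\<in>prime_factors n. - prime_log r)"
  proof (rule sum.cong[OF refl])
    fix r assume "r \<in> prime_factors n"
    then have r: "real r > 1" using prime_gt_1_nat[of r] by auto
    then have "1 - 1 / real r = inverse (1 + 1 / (real r - 1))" by (simp add: field_simps)
    moreover have "1 + 1 / (real r - 1) > 0" using r by (simp add: add_pos_pos)
    ultimately show "ln (1 - 1 / real r) = - prime_log r"
      by (simp add: prime_log_def ln_inverse)
  qed
  finally show ?thesis by (simp add: sum_negf)
qed

text \<open>Primes in \<open>Z\<close> that divide \<open>b\<close> also divide \<open>a\<close>, so their contributions cancel in favour
of the claim; what remains of \<open>b\<close> has to be outweighed by \<open>Q\<close> alone.\<close>

lemma totient_less_by_prime_logs: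
  assumes pos: "a > 0" "b > 0" and Q: "finite Q" "Q \<subseteq> prime_factors a"
    and small: "\<And>r. prime r \<Longrightarrow> r \<in> Z \<Longrightarrow> r dvd b \<Longrightarrow> r dvd a" and QZ: "Q \<inter> Z = {}"
    and gap: "ln (real a) - ln (real b) + (\<Sum>r\<in>prime_factors b - Z. prime_log r) < (\<Sum>r\<in>Q. prime_log r)"
  shows "totient a < totient b"
proof -
  have "(\<Sum>r\<in>prime_factors b. prime_log r)
      = (\<Sum>r\<in>prime_factors b \<inter> Z. prime_log r) + (\<Sum>r\<in>prime_factors b - Z. prime_log r)"
    by (subst sum.union_disjoint[symmetric]) (auto intro: sum.cong simp: Int_Diff_Un)
  moreover have "(\<Sum>r\<in>(prime_factors b \<inter> Z) \<union> Q. prime_log r) \<le> (\<Sum>r\<in>prime_factors a. prime_log r)"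
  proof (intro sum_mono2 prime_log_nonneg)
    show "prime_factors b \<inter> Z \<union> Q \<subseteq> prime_factors a"
      using small Q(2) pos by (auto simp: in_prime_factors_iff)
  qed auto
  moreover have "(\<Sum>r\<in>(prime_factors b \<inter> Z) \<union> Q. prime_log r)
      = (\<Sum>r\<in>prime_factors b \<inter> Z. prime_log r) + (\<Sum>r\<in>Q. prime_log r)"
    using Q QZ by (intro sum.union_disjoint) auto
  ultimately have "ln (real (totient a)) < ln (real (totient b))"
    using gap by (simp add: ln_totient pos)
  then show ?thesis using pos by (simp add: ln_less_cancel_iff)
qed

text \<open>The number \<open>A\<close> of the introduction is \<open>shifted k s p\<close>, and \<open>B\<close> is \<open>shifted k (-s) p\<close>.\<close>

definition shifted :: "nat \<Rightarrow> int \<Rightarrow> nat \<Rightarrow> nat" where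
  "shifted k t p = (if t = 1 then p + k - 1 else p - 1)"

text \<open>A natural number in the residue class \<open>1 - k\<close> (for \<open>t = 1\<close>) or \<open>1\<close> modulo \<open>M\<close>.\<close>

definition shift_class :: "nat \<Rightarrow> int \<Rightarrow> nat \<Rightarrow> nat" where
  "shift_class k t M = (if t = 1 then 1 + k * (M - 1) else 1)"

lemma dvd_shifted_iff:
  assumes "p > 0" "M > 0"
  shows "M dvd shifted k t p \<longleftrightarrow> [p = shift_class k t M] (mod M)"
proof (cases "t = 1")
  case True
  have "[p = 1 + k * (M - 1)] (mod M) \<longleftrightarrow> [p + k = 1 + k * (M - 1) + k] (mod M)"
    by (rule cong_add_rcancel_nat[symmetric])
  also have "1 + k * (M - 1) + k = 1 + k * M" using assms(2) by (cases M) auto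
  also have "[p + k = 1 + k * M] (mod M) \<longleftrightarrow> [p + k = 1] (mod M)"
    unfolding cong_def by (metis mod_mult_self1)
  also have "\<dots> \<longleftrightarrow> M dvd p + k - 1" using assms(1) by (subst cong_altdef_nat) auto
  finally show ?thesis using True by (simp add: shifted_def shift_class_def)
next
  case False
  then show ?thesis using assms(1) unfolding shifted_def shift_class_def
    by (simp add: cong_altdef_nat)
qed

text \<open>Admissibility of the residue classes: with \<open>a\<close> congruent to \<open>1 - k\<close> or to \<open>1\<close>, the
product \<open>a (a + k)\<close> is congruent to \<open>1 - k\<close> or to \<open>1 + k\<close>, that is, to
\<open>k - t\<close> up to sign.\<close>

lemma shift_class_not_dvd:
  assumes "prime q" "q dvd M" "M > 0" "t = 1 \<or> t = -1" "\<not> int q dvd int k - t"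
  shows "\<not> q dvd shift_class k t M * (shift_class k t M + k)"
proof -
  define a where "a = int (shift_class k t M)"
  have "[a * (a + int k) = (if t = 1 then 1 - int k else 1 + int k)] (mod int q)"
  proof (cases "t = 1")
    case True
    have "a = 1 - int k + int M * int k"
      using True assms(3) by (simp add: a_def shift_class_def of_nat_diff algebra_simps)
    moreover have "[int M * int k = 0] (mod int q)" using assms(2) by (simp add: cong_0_iff)
    ultimately have a: "[a = 1 - int k] (mod int q)"
      by (metis add.right_neutral cong_add cong_refl)
    then have "[a + int k = 1 - int k + int k] (mod int q)" by (intro cong_add cong_refl)
    then have "[a * (a + int k) = (1 - int k) * 1] (mod int q)"
      using a by (intro cong_mult) auto
    then show ?thesis using True by simp
  qed (simp add: a_def shift_class_def)
  moreover have "\<not> int q dvd (if t = 1 then 1 - int k else 1 + int k)"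
  proof (cases "t = 1")
    case True
    then show ?thesis using assms(5) dvd_diff_commute[of "int q" 1 "int k"] by simp
  next
    case False
    then show ?thesis using assms(4,5) by (simp add: add.commute)
  qed
  ultimately have "\<not> int q dvd a * (a + int k)" using cong_dvd_iff by blast
  then show ?thesis unfolding a_def by (metis int_dvd_int_iff of_nat_add of_nat_mult)
qed

section \<open>The inequality between \<open>R\<close> and \<open>L\<close>\<close>

abbreviation (input) Q_pool :: "nat \<Rightarrow> int \<Rightarrow> nat set" where
  "Q_pool k s \<equiv> {q. prime q \<and> \<not> int q dvd int k * (int k - s)}"

lemma finite_dvd_int:
  assumes "X \<noteq> 0"
  shows "finite {q. int q dvd X}"
proof (rule finite_subset)
  show "{q. int q dvd X} \<subseteq> {..nat \<bar>X\<bar>}"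
  proof
    fix q assume "q \<in> {q. int q dvd X}"
    then have "\<bar>int q\<bar> \<le> \<bar>X\<bar>" using assms by (intro dvd_imp_le_int) auto
    then show "q \<in> {..nat \<bar>X\<bar>}" by auto
  qed
qed auto

lemma infinite_Q_pool:
  assumes "int k * (int k - s) \<noteq> 0"
  shows "infinite (Q_pool k s)"
proof
  assume fin: "finite (Q_pool k s)"
  have "{q. prime q} \<subseteq> Q_pool k s \<union> {q. int q dvd int k * (int k - s)}" by auto
  then have "finite {q::nat. prime q}"
    using fin finite_dvd_int[OF assms] by (meson finite_Un finite_subset)
  then show False using primes_infinite by blast
qed

lemma Q_upto_subset:
  assumes "int k * (int k - s) \<noteq> 0"
  shows "Q_upto k s m \<subseteq> Q_pool k s"
  unfolding Q_upto_def q_seq_def using enumerate_in_set[OF infinite_Q_pool[OF assms]] by blast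

lemma Q_upto_contains:
  assumes "int k * (int k - s) \<noteq> 0" "q \<in> Q_pool k s" "q < m"
  shows "q \<in> Q_upto k s m"
proof -
  obtain j where j: "enumerate (Q_pool k s) j = q"
    using enumerate_Ex[OF infinite_Q_pool[OF assms(1)] assms(2)] by blast
  have "j \<le> q" using le_enumerate[OF infinite_Q_pool[OF assms(1)], of j] j by simp
  then have "Suc j \<in> {1..m}" using assms(3) by auto
  moreover have "q_seq k s (Suc j) = q" using j by (simp add: q_seq_def)
  ultimately show ?thesis unfolding Q_upto_def by blast
qed

text \<open>The product over all primes up to \<open>n\<close> is at least the harmonic number of \<open>n\<close>, and only
finitely many primes are missing from the pool.\<close>

lemma L_upto_unbounded:
  assumes "int k * (int k - s) \<noteq> 0"
  shows "\<exists>m\<ge>1. L_upto k s m > R"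
proof -
  define B where "B = {q::nat. prime q \<and> int q dvd int k * (int k - s)}"
  have fB: "finite B" unfolding B_def by (rule finite_subset[OF _ finite_dvd_int[OF assms]]) auto
  define K where "K = (\<Prod>l\<in>B. 1 + 1 / (real l - 1))"
  have K1: "K \<ge> 1" unfolding K_def by (intro prod_ge_1 euler_factor_bounds(1)) (auto simp: B_def)
  obtain n :: nat where n: "harm n > K * exp R"
    using harm_at_top unfolding filterlim_at_top_dense eventually_sequentially by blast
  define P where "P = {q. prime q \<and> q \<le> n \<and> q \<notin> B}"
  have fP: "finite P" by (simp add: P_def)
  have "harm n \<le> (\<Sum>W\<in>sieve_support (P \<union> B) (real n). euler_weight W)"
    using fP fB by (intro harm_le_euler_mass) (auto simp: P_def B_def)
  also have "\<dots> \<le> K * (\<Sum>W\<in>sieve_support P (real n). euler_weight W)"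
    unfolding K_def using fP fB by (intro euler_mass_remove_primes) (auto simp: P_def B_def)
  also have "(\<Sum>W\<in>sieve_support P (real n). euler_weight W) \<le> (\<Sum>W\<in>Pow P. euler_weight W)"
    using fP by (intro sum_mono2 euler_weight_nonneg) (auto simp: sieve_support_def P_def)
  also have "\<dots> = (\<Prod>l\<in>P. 1 + 1 / (real l - 1))"
    unfolding euler_weight_def by (rule sum_Pow_prod[OF fP])
  also have "\<dots> \<le> (\<Prod>l\<in>Q_upto k s (n + 1). 1 + 1 / (real l - 1))"
  proof (rule prod_mono2)
    show "finite (Q_upto k s (n + 1))" by (simp add: Q_upto_def)
    show "P \<subseteq> Q_upto k s (n + 1)"
      using Q_upto_contains[OF assms] by (auto simp: P_def B_def)
  qed (use euler_factor_bounds(1) Q_upto_subset[OF assms] in \<open>force simp: P_def\<close>)+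
  finally have "harm n \<le> K * (\<Prod>l\<in>Q_upto k s (n + 1). 1 + 1 / (real l - 1))"
    using K1 by simp
  with n have "K * exp R < K * (\<Prod>l\<in>Q_upto k s (n + 1). 1 + 1 / (real l - 1))" by linarith
  then have "exp R < (\<Prod>l\<in>Q_upto k s (n + 1). 1 + 1 / (real l - 1))" using K1 by simp
  then have "R < L_upto k s (n + 1)" unfolding L_upto_def
    by (metis exp_gt_zero exp_less_cancel_iff exp_ln less_trans)
  then show ?thesis by (intro exI[of _ "n + 1"]) auto
qed

definition R_term :: "nat \<Rightarrow> nat \<Rightarrow> real" where
  "R_term k r = 1 / (real r - real (pair_roots k r)) * prime_log r"

lemma R_term_bounds:
  assumes "prime r" "r \<ge> 5"
  shows "0 \<le> R_term k r" "R_term k r \<le> 4 * inverse (real r ^ 2)"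
proof -
  have "real (pair_roots k r) \<le> 2" using pair_roots_prime[OF assms(1), of k] by simp
  then have d: "real r - real (pair_roots k r) \<ge> real r / 2" "real r > 0" using assms(2) by linarith+
  then show "0 \<le> R_term k r"
    unfolding R_term_def using prime_log_nonneg[OF assms(1)] by (intro mult_nonneg_nonneg) auto
  have "R_term k r \<le> 1 / (real r / 2) * (2 / real r)"
    unfolding R_term_def using d prime_log_nonneg[OF assms(1)] prime_log_le[OF assms(1)]
    by (intro mult_mono divide_left_mono) auto
  also have "\<dots> = 4 * inverse (real r ^ 2)" by (simp add: field_simps power2_eq_square)
  finally show "R_term k r \<le> 4 * inverse (real r ^ 2)" .
qed

definition R_range :: "nat \<Rightarrow> int \<Rightarrow> nat set \<Rightarrow> nat set" where
  "R_range k s Q = {r. prime r \<and> 5 \<le> r \<and> r \<notin> Q \<and> \<not> int r dvd int k + s}"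

lemma summable_R_term: "summable (\<lambda>r. if r \<in> R_range k s Q then R_term k r else 0)"
proof (rule summable_comparison_test)
  show "\<exists>N. \<forall>r\<ge>N. norm (if r \<in> R_range k s Q then R_term k r else 0) \<le> 4 * inverse (real r ^ 2)"
    using R_term_bounds by (auto simp: R_range_def)
  show "summable (\<lambda>n. 4 * inverse ((real n)\<^sup>2))"
    using inverse_power_summable[of 2] by (intro summable_mult) auto
qed

lemma R_upto_eq_suminf:
  "R_upto k s m = (\<Sum>r. if r \<in> R_range k s (Q_upto k s m) then R_term k r else 0)"
proof -
  define g where "g r = (if r \<in> R_range k s (Q_upto k s m) then R_term k r else 0)" for r
  have g0: "g r \<ge> 0" for r using R_term_bounds(1) by (auto simp: g_def R_range_def)
  have "summable g" unfolding g_def by (rule summable_R_term)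
  then have "(g has_sum suminf g) UNIV"
    using g0 by (intro norm_summable_imp_has_sum) (auto simp: summable_sums)
  then have "infsum g UNIV = suminf g" by (rule infsumI)
  moreover have "R_upto k s m = infsum g UNIV"
    unfolding R_upto_def by (rule infsum_cong_neutral) (auto simp: g_def R_range_def R_term_def prime_log_def)
  ultimately have "R_upto k s m = suminf g" by simp
  then show ?thesis unfolding g_def .
qed

lemma R_upto_nonneg: "R_upto k s m \<ge> 0"
  unfolding R_upto_eq_suminf using R_term_bounds(1)
  by (intro suminf_nonneg summable_R_term) (auto simp: R_range_def)

text \<open>Enlarging \<open>Q\<close> only removes terms, so the sum for the empty set is a bound in which \<open>m\<close> does not
occur.  As \<open>L_upto\<close> is unbounded, the index that defines \<open>Q\<close> exists.\<close>

lemma R_upto_bounded: "R_upto k s m \<le> (\<Sum>r. if r \<in> R_range k s {} then R_term k r else 0)"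
  unfolding R_upto_eq_suminf using R_term_bounds(1)
  by (intro suminf_le summable_R_term) (auto simp: R_range_def)

lemma R_val_less_L_val:
  assumes "int k * (int k - s) \<noteq> 0"
  shows "0 \<le> R_val k s" "R_val k s < L_val k s"
proof -
  show "0 \<le> R_val k s" unfolding R_val_def by (rule R_upto_nonneg)
  obtain m where m: "m \<ge> 1" "L_upto k s m > (\<Sum>r. if r \<in> R_range k s {} then R_term k r else 0)"
    using L_upto_unbounded[OF assms] by blast
  then have "1 \<le> m \<and> L_upto k s m > R_upto k s m"
    using R_upto_bounded[of k s m] by simp
  then have "1 \<le> m_index k s \<and> L_upto k s (m_index k s) > R_upto k s (m_index k s)"
    unfolding m_index_def by (rule LeastI)
  then show "R_val k s < L_val k s" by (simp add: R_val_def L_val_def)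
qed

section \<open>Proportions and the mean contribution of the opposing shift\<close>

definition pairs_upto :: "nat \<Rightarrow> real \<Rightarrow> nat set" where
  "pairs_upto k x = {p \<in> prime_pairs k. real p \<le> x}"

lemma finite_pairs_upto: "finite (pairs_upto k x)"
  unfolding pairs_upto_def by (rule finite_subset[of _ "{..nat \<lfloor>x\<rfloor>}"]) (auto simp: le_nat_floor)

lemma prime_factors_prod_primes:
  fixes V :: "nat set"
  assumes "finite V" "\<And>q. q \<in> V \<Longrightarrow> prime q"
  shows "prime_factors (\<Prod>V) = V"
proof -
  have "\<Prod>V > 0" using assms(2) by (intro prod_pos) (simp add: prime_gt_0_nat)
  moreover have "p dvd \<Prod>V \<longleftrightarrow> p \<in> V" if "prime p" for p
  proof -
    have "p dvd \<Prod>V \<longleftrightarrow> (\<exists>q\<in>V. p dvd q)"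
      using prime_dvd_prod_iff[OF assms(1) that, of "\<lambda>q. q"] by simp
    then show ?thesis using that assms(2) by (metis dvd_refl primes_dvd_imp_eq)
  qed
  ultimately show ?thesis using assms(2) by (auto simp: in_prime_factors_iff)
qed

text \<open>For squarefree modulus the Euler factors and the modulus combine to \<open>1/(q - N(q))\<close>, the reciprocal of the
number of residue classes that prime pairs can occupy modulo \<open>q\<close>.\<close>

lemma prime_pairs_squarefree_class_asymp:
  assumes BH: "Bateman_Horn_conjecture" and k: "k > 0" "even k"
    and V: "finite V" "\<And>q. q \<in> V \<Longrightarrow> prime q" "\<And>q. q \<in> V \<Longrightarrow> \<not> q dvd c * (c + k)"
  shows "((\<lambda>x. real (card {p \<in> pairs_upto k x. [p = c] (mod \<Prod>V)}) / (x / (ln x)\<^sup>2))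
     \<longlongrightarrow> pair_const k * (\<Prod>q\<in>V. 1 / (real q - real (pair_roots k q)))) at_top"
proof -
  define M where "M = \<Prod>V"
  define c' where "c' = c mod M"
  have M0: "M > 0" unfolding M_def using V(2) by (intro prod_pos) (simp add: prime_gt_0_nat)
  have c': "[c' = c] (mod M)" "c' < M" using M0 by (auto simp: c'_def)
  have "coprime (c * (c + k)) M" unfolding M_def
    using V by (intro prod_coprime_right) (metis coprime_commute prime_imp_coprime)
  moreover have "[c * (c + k) = c' * (c' + k)] (mod M)"
    using c' by (intro cong_mult cong_add cong_refl) (auto intro: cong_sym)
  ultimately have cop: "coprime (c' * (c' + k)) M"
    using cong_imp_coprime coprime_commute by blast
  have "(\<Prod>p\<in>prime_factors M. real p / (real p - real (pair_roots k p))) / real M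
      = (\<Prod>p\<in>V. real p / (real p - real (pair_roots k p))) / (\<Prod>p\<in>V. real p)"
    using prime_factors_prod_primes[OF V(1,2)] by (simp add: M_def)
  also have "\<dots> = (\<Prod>p\<in>V. real p / (real p - real (pair_roots k p)) / real p)"
    by (rule prod_dividef[symmetric])
  also have "\<dots> = (\<Prod>q\<in>V. 1 / (real q - real (pair_roots k q)))"
    using V(2) by (intro prod.cong refl) (auto dest: prime_gt_0_nat)
  finally have eq: "pair_const k * (\<Prod>p\<in>prime_factors M. real p / (real p - real (pair_roots k p))) / real M
     = pair_const k * (\<Prod>q\<in>V. 1 / (real q - real (pair_roots k q)))"
    unfolding times_divide_eq_right[of "pair_const k" _ "real M", symmetric]
    by (rule arg_cong)
  have "[p = c'] (mod M) \<longleftrightarrow> [p = c] (mod M)" for p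
    using c'(1) by (metis cong_sym cong_trans)
  then have sets: "{p \<in> pairs_upto k x. [p = c] (mod \<Prod>V)} = {p \<in> prime_pairs k. real p \<le> x \<and> [p = c'] (mod M)}" for x
    by (auto simp: pairs_upto_def M_def)
  show ?thesis
    using prime_pairs_class_asymp[OF BH k M0 c'(2) cop] unfolding eq sets .
qed

lemma card_pairs_upto_asymp:
  assumes "Bateman_Horn_conjecture" "k > 0" "even k"
  shows "((\<lambda>x. real (card (pairs_upto k x)) / (x / (ln x)\<^sup>2)) \<longlongrightarrow> pair_const k) at_top"
  using prime_pairs_squarefree_class_asymp[OF assms, of "{}" 0] by simp

lemma eventually_card_pairs_upto_ge:
  assumes "Bateman_Horn_conjecture" "k > 0" "even k"
  shows "eventually (\<lambda>x. real (card (pairs_upto k x)) \<ge> pair_const k / 2 * (x / (ln x)\<^sup>2) \<and> x / (ln x)\<^sup>2 > 0) at_top"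
proof -
  have "eventually (\<lambda>x. real (card (pairs_upto k x)) / (x / (ln x)\<^sup>2) > pair_const k / 2) at_top"
    using pair_const_pos[OF assms(2,3)] by (intro order_tendstoD(1)[OF card_pairs_upto_asymp[OF assms]]) auto
  moreover have "eventually (\<lambda>x::real. x / (ln x)\<^sup>2 > 0) at_top" by real_asymp
  ultimately show ?thesis by eventually_elim (metis less_imp_le pos_less_divide_eq)
qed

lemma card_pairs_upto_at_top:
  assumes "Bateman_Horn_conjecture" "k > 0" "even k"
  shows "filterlim (\<lambda>x. real (card (pairs_upto k x))) at_top at_top"
proof (rule filterlim_at_top_mono)
  show "filterlim (\<lambda>x::real. pair_const k / 2 * (x / (ln x)\<^sup>2)) at_top at_top"
    using pair_const_pos[OF assms(2,3)] by real_asymp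
qed (use eventually_card_pairs_upto_ge[OF assms] in eventually_elim, auto)

lemma prime_pairs_class_proportion:
  assumes BH: "Bateman_Horn_conjecture" and k: "k > 0" "even k"
    and V: "finite V" "\<And>q. q \<in> V \<Longrightarrow> prime q" "\<And>q. q \<in> V \<Longrightarrow> \<not> q dvd c * (c + k)"
  shows "((\<lambda>x. real (card {p \<in> pairs_upto k x. [p = c] (mod \<Prod>V)}) / real (card (pairs_upto k x)))
     \<longlongrightarrow> (\<Prod>q\<in>V. 1 / (real q - real (pair_roots k q)))) at_top"
proof -
  have pos: "pair_const k > 0" by (rule pair_const_pos[OF k])
  have cancel: "(u / w) / (v / w) = u / v" if "w > 0" for u v w :: real using that by simp
  have "((\<lambda>x. (real (card {p \<in> pairs_upto k x. [p = c] (mod \<Prod>V)}) / (x / (ln x)\<^sup>2)) /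
             (real (card (pairs_upto k x)) / (x / (ln x)\<^sup>2)))
     \<longlongrightarrow> (pair_const k * (\<Prod>q\<in>V. 1 / (real q - real (pair_roots k q)))) / pair_const k) at_top"
    using pos by (intro tendsto_divide prime_pairs_squarefree_class_asymp card_pairs_upto_asymp assms) auto
  moreover have "eventually (\<lambda>x. (real (card {p \<in> pairs_upto k x. [p = c] (mod \<Prod>V)}) / (x / (ln x)\<^sup>2)) /
             (real (card (pairs_upto k x)) / (x / (ln x)\<^sup>2))
      = real (card {p \<in> pairs_upto k x. [p = c] (mod \<Prod>V)}) / real (card (pairs_upto k x))) at_top"
    using eventually_card_pairs_upto_ge[OF BH k] by eventually_elim (rule cancel, blast)
  ultimately show ?thesis using pos by (auto intro: Lim_transform_eventually)
qed

lemma prime_pairs_two_class_proportion: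
  assumes BH: "Bateman_Horn_conjecture" and k: "k > 0" "even k"
    and V: "finite V" "\<And>q. q \<in> V \<Longrightarrow> prime q" "\<And>q. q \<in> V \<Longrightarrow> \<not> q dvd a * (a + k)"
    and r: "prime r" "r \<notin> V" "\<not> r dvd b * (b + k)"
  shows "((\<lambda>x. real (card {p \<in> pairs_upto k x. [p = a] (mod \<Prod>V) \<and> [p = b] (mod r)}) / real (card (pairs_upto k x)))
     \<longlongrightarrow> (\<Prod>q\<in>V. 1 / (real q - real (pair_roots k q))) * (1 / (real r - real (pair_roots k r)))) at_top"
proof -
  have cop: "coprime (\<Prod>V) r"
    using V(2) r by (intro prod_coprime_left) (metis primes_coprime)
  obtain c where c: "\<And>n. [n = a] (mod \<Prod>V) \<and> [n = b] (mod r) \<longleftrightarrow> [n = c] (mod (\<Prod>V * r))"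
    using cong_pair_iff_cong_mult[OF cop] by metis
  have cc: "[c = a] (mod \<Prod>V)" "[c = b] (mod r)" using c[of c] by auto
  have ins: "\<Prod>(insert r V) = \<Prod>V * r" using V(1) r(2) by (simp add: mult.commute)
  have nd: "\<not> q dvd c * (c + k)" if "q \<in> insert r V" for q
  proof (cases "q = r")
    case True
    have "[c * (c + k) = b * (b + k)] (mod r)" using cc by (intro cong_mult cong_add cong_refl)
    then show ?thesis using True r(3) cong_dvd_iff by blast
  next
    case False
    then have q: "q \<in> V" using that by simp
    then have "q dvd \<Prod>V" using V(1) by (simp add: dvd_prod_eqI)
    then have "[c = a] (mod q)" using cc(1) cong_dvd_modulus_nat by blast
    then have "[c * (c + k) = a * (a + k)] (mod q)" by (intro cong_mult cong_add cong_refl)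
    then show ?thesis using V(3)[OF q] cong_dvd_iff by blast
  qed
  have pr: "\<And>q. q \<in> insert r V \<Longrightarrow> prime q" using V r by auto
  have "((\<lambda>x. real (card {p \<in> pairs_upto k x. [p = c] (mod \<Prod>(insert r V))}) / real (card (pairs_upto k x)))
     \<longlongrightarrow> (\<Prod>q\<in>insert r V. 1 / (real q - real (pair_roots k q)))) at_top"
    using V(1) pr nd by (intro prime_pairs_class_proportion[OF BH k]) auto
  then show ?thesis using V(1) r(2) unfolding ins c[symmetric] by (simp add: mult.commute)
qed

text \<open>What \<open>B\<close> contributes to the comparison of totients.  The range of \<open>r\<close> is that of the sum
\<open>R\<close>; when \<open>A\<close> is divisible by all of \<open>Q\<close> and \<open>p > k\<close>, it leaves out only the primes 2 and 3
(see \<open>opposing_sum_small_imp_sgn_T\<close>).\<close>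

definition opposing_sum :: "nat \<Rightarrow> int \<Rightarrow> nat set \<Rightarrow> nat \<Rightarrow> real" where
  "opposing_sum k s Q p = (\<Sum>r\<in>prime_factors (shifted k (-s) p) \<inter> R_range k s Q. prime_log r)"

lemma shifted_bounds:
  assumes "prime p"
  shows "0 < shifted k t p" "shifted k t p < p + k"
  using prime_ge_2_nat[OF assms] by (auto simp: shifted_def)

lemma sum_opposing_sum_exchange:
  fixes k :: nat and x :: real
  assumes "x \<ge> 0"
  defines "n \<equiv> nat \<lfloor>x\<rfloor> + k"
  assumes D: "D \<subseteq> pairs_upto k x"
  shows "(\<Sum>p\<in>D. opposing_sum k s Q p)
     = (\<Sum>r\<le>n. if r \<in> R_range k s Q then prime_log r * real (card {p\<in>D. r dvd shifted k (-s) p}) else 0)"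
proof -
  have fD: "finite D" using D finite_pairs_upto finite_subset by blast
  have "opposing_sum k s Q p = (\<Sum>r\<le>n. if r \<in> R_range k s Q \<and> r dvd shifted k (-s) p then prime_log r else 0)"
    if "p \<in> D" for p
  proof -
    have p: "prime p" "real p \<le> x" using that D by (auto simp: pairs_upto_def prime_pairs_def)
    have "p \<le> nat \<lfloor>x\<rfloor>" using p(2) by (simp add: le_nat_floor)
    then have b: "0 < shifted k (-s) p" "shifted k (-s) p \<le> n"
      using shifted_bounds[OF p(1), of k "-s"] by (auto simp: n_def)
    show ?thesis unfolding opposing_sum_def
    proof (rule sum.mono_neutral_cong_left)
      show "prime_factors (shifted k (- s) p) \<inter> R_range k s Q \<subseteq> {..n}"
        using b by (auto simp: in_prime_factors_iff dest!: dvd_imp_le)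
    qed (use b in \<open>auto simp: in_prime_factors_iff R_range_def\<close>)
  qed
  then have "(\<Sum>p\<in>D. opposing_sum k s Q p)
     = (\<Sum>p\<in>D. \<Sum>r\<le>n. if r \<in> R_range k s Q \<and> r dvd shifted k (-s) p then prime_log r else 0)"
    by (intro sum.cong) auto
  also have "\<dots> = (\<Sum>r\<le>n. \<Sum>p\<in>D. if r \<in> R_range k s Q \<and> r dvd shifted k (-s) p then prime_log r else 0)"
    by (rule sum.swap)
  also have "\<dots> = (\<Sum>r\<le>n. if r \<in> R_range k s Q then prime_log r * real (card {p\<in>D. r dvd shifted k (-s) p}) else 0)"
  proof (rule sum.cong[OF refl])
    fix r
    have "(\<Sum>p\<in>D. if r dvd shifted k (-s) p then prime_log r else 0) = (\<Sum>p | p \<in> D \<and> r dvd shifted k (-s) p. prime_log r)"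
      by (rule sum.inter_filter[OF fD, symmetric])
    then show "(\<Sum>p\<in>D. if r \<in> R_range k s Q \<and> r dvd shifted k (-s) p then prime_log r else 0)
       = (if r \<in> R_range k s Q then prime_log r * real (card {p\<in>D. r dvd shifted k (-s) p}) else 0)"
      by simp
  qed
  finally show ?thesis .
qed

text \<open>Exchanging the sums over \<open>p\<close> and \<open>r\<close> turns the mean into a series over \<open>r\<close> whose terms
converge by \<open>prime_pairs_two_class_proportion\<close>.  The uniform upper bound and
\<open>prime_log r \<le> 2/r\<close> dominate the terms by a multiple of \<open>r powr (-3/2)\<close>, so Tannery's theorem
gives the limit term by term.\<close>

lemma mean_opposing_sum:
  assumes BH: "Bateman_Horn_conjecture" and k: "k > 0" "even k" and s: "s = 1 \<or> s = -1"
    and Q: "finite Q" "\<And>q. q \<in> Q \<Longrightarrow> prime q" "\<And>q. q \<in> Q \<Longrightarrow> \<not> q dvd a * (a + k)"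
  shows "((\<lambda>x. (\<Sum>p | p \<in> pairs_upto k x \<and> [p = a] (mod \<Prod>Q). opposing_sum k s Q p) / real (card (pairs_upto k x)))
     \<longlongrightarrow> (\<Prod>q\<in>Q. 1 / (real q - real (pair_roots k q))) *
           (\<Sum>r. if r \<in> R_range k s Q then R_term k r else 0)) at_top"
proof -
  define \<delta> where "\<delta> = (\<Prod>q\<in>Q. 1 / (real q - real (pair_roots k q)))"
  define D where "D x = {p. p \<in> pairs_upto k x \<and> [p = a] (mod \<Prod>Q)}" for x
  define cnt where "cnt r x = card {p\<in>D x. r dvd shifted k (-s) p}" for r x
  define f where "f r x = (if r \<in> R_range k s Q then prime_log r * (real (cnt r x) / real (card (pairs_upto k x))) else 0)" for r x
  define g where "g r = \<delta> * (if r \<in> R_range k s Q then R_term k r else 0)" for r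
  obtain C where C: "C > 0" "eventually (\<lambda>x. \<forall>r a. prime r \<longrightarrow> real r \<le> 2 * x \<longrightarrow>
     real (card {p \<in> prime_pairs k. real p \<le> x \<and> [p = a] (mod r)}) \<le> C * (x / (ln x)\<^sup>2) / sqrt (real r)) at_top"
    using prime_pairs_class_uniform_bound[OF k(2,1)] by blast
  define c where "c = pair_const k"
  have c0: "c > 0" unfolding c_def by (rule pair_const_pos[OF k])
  have cancel: "(C * w / u) / (c / 2 * w) = 2 * C / c / u" if "w > 0" for w u :: real
    using that c0 by (simp add: field_simps)
  define M where "M r = 4 * C / c * real r powr (-3/2)" for r
  have Dp: "prime p" "real p \<le> x" "p \<in> prime_pairs k" if "p \<in> D x" for p x
    using that by (auto simp: D_def pairs_upto_def prime_pairs_def)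
  have dvd: "r dvd shifted k (-s) p \<longleftrightarrow> [p = shift_class k (-s) r] (mod r)" if "prime p" "prime r" for p r
    using that by (intro dvd_shifted_iff) (simp_all add: prime_gt_0_nat)
  have limit: "((\<lambda>x. f r x) \<longlongrightarrow> g r) at_top" for r
  proof (cases "r \<in> R_range k s Q")
    case True
    then have r: "prime r" "r \<notin> Q" "\<not> int r dvd int k - (-s)" by (auto simp: R_range_def)
    have nd: "\<not> r dvd shift_class k (-s) r * (shift_class k (-s) r + k)"
      using r s by (intro shift_class_not_dvd) (auto simp: prime_gt_0_nat)
    have sets: "{p\<in>D x. r dvd shifted k (-s) p}
       = {p \<in> pairs_upto k x. [p = a] (mod \<Prod>Q) \<and> [p = shift_class k (-s) r] (mod r)}" for x
      using dvd[OF _ r(1)] by (auto simp: D_def pairs_upto_def prime_pairs_def)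
    have "((\<lambda>x. prime_log r * (real (cnt r x) / real (card (pairs_upto k x))))
        \<longlongrightarrow> prime_log r * (\<delta> * (1 / (real r - real (pair_roots k r))))) at_top"
      unfolding cnt_def sets \<delta>_def
      by (intro tendsto_mult tendsto_const prime_pairs_two_class_proportion[OF BH k Q r(1,2) nd])
    then show ?thesis using True by (simp add: f_def g_def R_term_def mult_ac)
  qed (simp add: f_def g_def)
  have "eventually (\<lambda>x. \<forall>r. norm (f r x) \<le> M r) at_top"
    using C(2) eventually_card_pairs_upto_ge[OF BH k] eventually_ge_at_top[of "real k"]
  proof eventually_elim
    case (elim x)
    show ?case
    proof
      fix r
      show "norm (f r x) \<le> M r"
      proof (cases "r \<in> R_range k s Q \<and> cnt r x > 0")
        case True
        then have r: "prime r" by (auto simp: R_range_def)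
        have r2: "real r > 0" using prime_gt_0_nat[OF r] by simp
        \<comment> \<open>A nonempty count forces \<open>r \<le> x + k \<le> 2 x\<close>, the range of the uniform bound.\<close>
        have "{p\<in>D x. r dvd shifted k (-s) p} \<noteq> {}"
          using True unfolding cnt_def by (metis card.empty less_irrefl)
        then obtain p where p: "p \<in> D x" "r dvd shifted k (-s) p" by blast
        have "r \<le> shifted k (-s) p" using p shifted_bounds(1)[OF Dp(1)[OF p(1)]] by (intro dvd_imp_le) auto
        also have "\<dots> \<le> p + k" using shifted_bounds(2)[OF Dp(1)[OF p(1)], of k "-s"] by simp
        finally have "real r \<le> real p + real k" by linarith
        then have r2x: "real r \<le> 2 * x" using Dp(2)[OF p(1)] elim by linarith
        have "cnt r x \<le> card {p \<in> prime_pairs k. real p \<le> x \<and> [p = shift_class k (-s) r] (mod r)}"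
          unfolding cnt_def
        proof (rule card_mono)
          show "finite {p \<in> prime_pairs k. real p \<le> x \<and> [p = shift_class k (-s) r] (mod r)}"
            by (rule finite_subset[OF _ finite_pairs_upto[of k x]]) (auto simp: pairs_upto_def)
        qed (use Dp dvd r in blast)
        also have "real \<dots> \<le> C * (x / (ln x)\<^sup>2) / sqrt (real r)" using elim r r2x by blast
        finally have "real (cnt r x) \<le> C * (x / (ln x)\<^sup>2) / sqrt (real r)" by simp
        moreover have "c / 2 * (x / (ln x)\<^sup>2) > 0"
          using elim c0 by (intro mult_pos_pos) auto
        ultimately have "real (cnt r x) / real (card (pairs_upto k x))
            \<le> (C * (x / (ln x)\<^sup>2) / sqrt (real r)) / (c / 2 * (x / (ln x)\<^sup>2))"
          using elim C(1) by (intro frac_le) (auto simp: c_def intro!: divide_nonneg_nonneg mult_nonneg_nonneg)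
        also have "\<dots> = 2 * C / c / sqrt (real r)" by (rule cancel) (use elim in blast)
        finally have 1: "real (cnt r x) / real (card (pairs_upto k x)) \<le> 2 * C / c / sqrt (real r)" .
        have "norm (f r x) = prime_log r * (real (cnt r x) / real (card (pairs_upto k x)))"
          using True prime_log_nonneg[OF r] by (simp add: f_def)
        also have "\<dots> \<le> (2 / real r) * (2 * C / c / sqrt (real r))"
          by (intro mult_mono 1 prime_log_le[OF r]) auto
        also have "\<dots> = 4 * C / c * (1 / (real r * sqrt (real r)))" by simp
        also have "1 / (real r * sqrt (real r)) = real r powr (-3/2)"
        proof -
          have "real r * sqrt (real r) = real r powr 1 * real r powr (1/2)"
            using r2 by (simp add: powr_half_sqrt)
          also have "\<dots> = real r powr (1 + 1/2)" by (simp only: powr_add)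
          also have "\<dots> = real r powr (3/2)" by simp
          finally show ?thesis by (simp add: powr_minus_divide)
        qed
        finally show ?thesis by (simp add: M_def)
      next
        case False
        then have "f r x = 0" by (auto simp: f_def)
        then show ?thesis using C(1) c0 by (simp add: M_def)
      qed
    qed
  qed
  then have bound: "eventually (\<lambda>(r,x). norm (f r x) \<le> M r) (at_top \<times>\<^sub>F at_top)"
    unfolding eventually_prod_filter
    by (intro exI[of _ "\<lambda>_. True"] exI[of _ "\<lambda>x. \<forall>r. norm (f r x) \<le> M r"]) auto
  have "summable M" unfolding M_def
    by (intro summable_mult) (simp add: summable_real_powr_iff)
  from tannerys_theorem[OF limit bound this]
  have "((\<lambda>x. suminf (\<lambda>r. f r x)) \<longlongrightarrow> suminf g) at_top" by simp
  moreover have "suminf g = \<delta> * (\<Sum>r. if r \<in> R_range k s Q then R_term k r else 0)"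
    unfolding g_def by (rule suminf_mult[OF summable_R_term])
  moreover have "eventually (\<lambda>x. suminf (\<lambda>r. f r x) = (\<Sum>p\<in>D x. opposing_sum k s Q p) / real (card (pairs_upto k x))) at_top"
    using eventually_ge_at_top[of 0]
  proof eventually_elim
    case (elim x)
    define n where "n = nat \<lfloor>x\<rfloor> + k"
    have zero: "f r x = 0" if "r \<notin> {..n}" for r
    proof -
      have "\<not> r dvd shifted k (-s) p" if p: "p \<in> D x" for p
      proof
        assume "r dvd shifted k (-s) p"
        then have "r \<le> shifted k (-s) p" using shifted_bounds(1)[OF Dp(1)[OF p]] by (intro dvd_imp_le) auto
        also have "\<dots> < p + k" by (rule shifted_bounds(2)[OF Dp(1)[OF p]])
        also have "p \<le> nat \<lfloor>x\<rfloor>" using Dp(2)[OF p] by (simp add: le_nat_floor)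
        finally show False using \<open>r \<notin> {..n}\<close> by (simp add: n_def)
      qed
      then have "{p\<in>D x. r dvd shifted k (-s) p} = {}" by blast
      then have "cnt r x = 0" by (simp only: cnt_def card.empty)
      then show ?thesis by (simp add: f_def)
    qed
    have "suminf (\<lambda>r. f r x) = (\<Sum>r\<le>n. f r x)"
      using zero by (intro suminf_finite) auto
    also have "\<dots> = (\<Sum>r\<le>n. if r \<in> R_range k s Q then prime_log r * real (card {p\<in>D x. r dvd shifted k (-s) p}) else 0)
         / real (card (pairs_upto k x))"
      unfolding sum_divide_distrib by (intro sum.cong refl) (simp add: f_def cnt_def)
    also have "(\<Sum>r\<le>n. if r \<in> R_range k s Q then prime_log r * real (card {p\<in>D x. r dvd shifted k (-s) p}) else 0)
        = (\<Sum>p\<in>D x. opposing_sum k s Q p)"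
      unfolding n_def using elim by (intro sum_opposing_sum_exchange[symmetric]) (auto simp: D_def)
    finally show ?case .
  qed
  ultimately show ?thesis unfolding \<delta>_def D_def
    by (auto intro: Lim_transform_eventually)
qed

section \<open>The sign of \<open>T\<close> and its density\<close>

lemma shifted_differ_by_k:
  assumes "p > 0" "s = 1 \<or> s = -1"
  shows "shifted k s p = shifted k (-s) p + k \<or> shifted k (-s) p = shifted k s p + k"
  using assms by (auto simp: shifted_def)

text \<open>The primes \<open>r \<ge> 5\<close> dividing \<open>B\<close> all belong to the range of the opposing sum: one in \<open>Q\<close> would
divide \<open>A\<close> as well and hence \<open>k\<close>, and one dividing \<open>k + s\<close> would divide, and so equal, one of the
primes \<open>p\<close> and \<open>p + k\<close>, which is impossible by size.\<close>

lemma opposing_sum_small_imp_sgn_T: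
  assumes p: "p \<in> prime_pairs k" "k < p" and k: "even k" "3 dvd k" and s: "s = 1 \<or> s = -1"
    and Q: "finite Q" "\<And>q. q \<in> Q \<Longrightarrow> prime q \<and> \<not> q dvd k" "\<Prod>Q dvd shifted k s p"
    and gap: "ln (real (shifted k s p)) - ln (real (shifted k (-s) p)) + opposing_sum k s Q p < (\<Sum>q\<in>Q. prime_log q)"
  shows "sgn (T k p) = s"
proof -
  define a where "a = shifted k s p"
  define b where "b = shifted k (-s) p"
  have pr: "prime p" "prime (p + k)" using p by (auto simp: prime_pairs_def)
  have pos: "a > 0" "b > 0" using shifted_bounds[OF pr(1)] by (auto simp: a_def b_def)
  have diff: "a = b + k \<or> b = a + k"
    unfolding a_def b_def using prime_gt_0_nat[OF pr(1)] s by (rule shifted_differ_by_k)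
  have common: "r dvd a" if "r dvd k" "r dvd b" for r
    using diff that by (metis dvd_add dvd_add_left_iff)
  have Qa: "q dvd a" if "q \<in> Q" for q
    using Q that prod_primes_dvd_iff[of Q a] by (auto simp: a_def)
  have "r \<in> R_range k s Q" if r: "r \<in> prime_factors b - {2, 3}" for r
  proof -
    have rp: "prime r" "r dvd b" using r by (auto simp: in_prime_factors_iff)
    have "r \<noteq> 4" using rp(1) by auto
    then have "5 \<le> r" using r prime_ge_2_nat[OF rp(1)] by auto
    moreover have "r \<notin> Q"
    proof
      assume "r \<in> Q"
      then have "r dvd a" "\<not> r dvd k" using Qa Q(2) by auto
      then show False using diff rp(2) by (metis dvd_add_right_iff)
    qed
    moreover have "\<not> int r dvd int k + s"
    proof
      assume dv: "int r dvd int k + s"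
      have p1: "p > 1" using prime_gt_1_nat[OF pr(1)] .
      show False
      proof (cases "s = 1")
        case True
        then have "int r dvd int (k + 1)" using dv by (simp add: add.commute)
        then have "r dvd k + 1" by (simp only: int_dvd_int_iff)
        moreover have "r dvd p - 1" using rp(2) True by (simp add: b_def shifted_def)
        ultimately have "r dvd (k + 1) + (p - 1)" by (rule dvd_add)
        then have "r dvd p + k" using p1 by (simp add: add.commute)
        then have "r = p + k" using primes_dvd_imp_eq[OF rp(1) pr(2)] by simp
        moreover have "r \<le> p - 1" using \<open>r dvd p - 1\<close> p1 by (intro dvd_imp_le) auto
        ultimately show False using p1 by simp
      next
        case False
        then have sm: "s = -1" using s by simp
        have k2: "k \<noteq> 1" using k(1) by auto
        have "k > 0 \<or> k = 0" by auto
        then show False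
        proof
          assume k0: "k > 0"
          have "int r dvd int (k - 1)" using dv sm k0 by (simp add: of_nat_diff)
          then have rk: "r dvd k - 1" by (simp only: int_dvd_int_iff)
          have "r dvd p + k - 1" using rp(2) sm by (simp add: b_def shifted_def)
          moreover have "p + k - 1 = p + (k - 1)" using k0 by simp
          ultimately have "r dvd p" using rk by (simp add: dvd_add_left_iff)
          then have "r = p" using primes_dvd_imp_eq[OF rp(1) pr(1)] by simp
          moreover have "r \<le> k - 1" using rk k0 k2 by (intro dvd_imp_le) auto
          ultimately show False using p(2) by simp
        next
          assume "k = 0"
          then have "int r dvd 1" using dv sm by simp
          then show False using rp(1) by (metis int_dvd_int_iff int_ops(2) not_prime_unit)
        qed
      qed
    qed
    ultimately show ?thesis using rp(1) by (simp add: R_range_def)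
  qed
  then have "(\<Sum>r\<in>prime_factors b - {2, 3}. prime_log r) \<le> opposing_sum k s Q p"
    unfolding opposing_sum_def b_def
    by (intro sum_mono2 prime_log_nonneg) (auto simp: R_range_def)
  then have g: "ln (real a) - ln (real b) + (\<Sum>r\<in>prime_factors b - {2, 3}. prime_log r) < (\<Sum>q\<in>Q. prime_log q)"
    using gap by (simp add: a_def b_def)
  have "totient a < totient b"
  proof (rule totient_less_by_prime_logs[OF pos Q(1) _ _ _ g])
    show "Q \<subseteq> prime_factors a" using Qa Q(2) pos by (auto simp: in_prime_factors_iff)
    show "r dvd a" if "r \<in> {2, 3}" "r dvd b" for r
      using that k common by auto
    show "Q \<inter> {2, 3} = {}" using Q(2) k by auto
  qed
  then show ?thesis using s by (auto simp: T_def a_def b_def shifted_def)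
qed

lemma ln_shifted_ratio_small:
  assumes "\<epsilon> > 0"
  obtains N :: nat where "\<And>p s. p > N \<Longrightarrow> prime p \<Longrightarrow> ln (real (shifted k s p)) - ln (real (shifted k (-s) p)) < \<epsilon>"
proof -
  have "((\<lambda>p::nat. ln (real p + real k) - ln (real p - 1)) \<longlongrightarrow> 0) at_top"
    by real_asymp
  then have "eventually (\<lambda>p::nat. ln (real p + real k) - ln (real p - 1) < \<epsilon>) at_top"
    using assms by (rule order_tendstoD(2))
  then obtain N where N: "\<And>p. p \<ge> N \<Longrightarrow> ln (real p + real k) - ln (real p - 1) < \<epsilon>"
    by (auto simp: eventually_sequentially)
  show thesis
  proof (rule that)
    fix p :: nat and s :: int assume p: "p > N" "prime p"
    have p2: "p \<ge> 2" by (rule prime_ge_2_nat[OF p(2)])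
    have "ln (real (shifted k s p)) \<le> ln (real p + real k)"
      using shifted_bounds[OF p(2), of k s] by (subst ln_le_cancel_iff) auto
    moreover have "ln (real p - 1) \<le> ln (real (shifted k (-s) p))"
    proof -
      have "p - 1 \<le> shifted k (-s) p" by (auto simp: shifted_def)
      then have "real p - 1 \<le> real (shifted k (-s) p)" by linarith
      then show ?thesis using p2 by (subst ln_le_cancel_iff) auto
    qed
    ultimately show "ln (real (shifted k s p)) - ln (real (shifted k (-s) p)) < \<epsilon>"
      using N[of p] p by simp
  qed
qed

theorem theorem10:
  fixes k :: nat and s :: int
  assumes "Bateman_Horn_conjecture"
    and "k > 0" and "even k" and "[k = 0] (mod 3)"
    and "s = 1 \<or> s = -1"
  shows "ereal ((\<Prod>q\<in>Q_set k s. inverse (real q - 2)) * (1 - R_val k s / L_val k s))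
           \<le> lower_density_in {p \<in> prime_pairs k. sgn (T k p) = s} (prime_pairs k)
    \<and> (\<Prod>q\<in>Q_set k s. inverse (real q - 2)) * (1 - R_val k s / L_val k s) > 0"
proof -
  note BH = assms(1) and k = assms(2,3) and s = assms(5)
  define Q where "Q = Q_set k s"
  define R where "R = R_val k s"
  define L where "L = L_val k s"
  define \<delta> where "\<delta> = (\<Prod>q\<in>Q. inverse (real q - 2))"
  define a where "a = shift_class k s (\<Prod>Q)"
  define G where "G = {p \<in> prime_pairs k. sgn (T k p) = s}"
  define \<pi> where "\<pi> x = real (card (pairs_upto k x))" for x
  define D where "D x = {p. p \<in> pairs_upto k x \<and> [p = a] (mod \<Prod>Q)}" for x
  have k3: "3 dvd k" using assms(4) by (simp add: cong_0_iff)
  have ne: "int k * (int k - s) \<noteq> 0"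
    using k s by auto
  have finQ: "finite Q" by (simp add: Q_def Q_set_def Q_upto_def)
  have Q: "prime q" "\<not> q dvd k" "\<not> int q dvd int k - s" if "q \<in> Q" for q
  proof -
    have q: "prime q" "\<not> int q dvd int k * (int k - s)"
      using Q_upto_subset[OF ne] that by (auto simp: Q_def Q_set_def)
    then show "prime q" "\<not> q dvd k" "\<not> int q dvd int k - s"
      by (auto intro: dvd_mult dvd_mult2)
  qed
  have Q_gt2: "real q > 2" if "q \<in> Q" for q
  proof -
    have "q \<noteq> 2" using Q(2)[OF that] k(2) by auto
    then show ?thesis using prime_ge_2_nat[OF Q(1)[OF that]] by linarith
  qed
  have P0: "\<Prod>Q > 0" using Q(1) by (intro prod_pos) (simp add: prime_gt_0_nat)
  have R: "0 \<le> R" "R < L" using R_val_less_L_val[OF ne] by (auto simp: R_def L_def)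
  have \<delta>0: "\<delta> > 0" unfolding \<delta>_def using Q_gt2 by (intro prod_pos) force
  have L_eq: "L = (\<Sum>q\<in>Q. prime_log q)"
  proof -
    have "1 + 1 / (real q - 1) \<noteq> 0" if "q \<in> Q" for q
      using Q_gt2[OF that] by (simp add: field_simps)
    then show ?thesis
      unfolding L_def L_val_def L_upto_def prime_log_def Q_def[symmetric] Q_set_def[symmetric]
      by (intro ln_prod finQ)
  qed
  have R_eq: "R = (\<Sum>r. if r \<in> R_range k s Q then R_term k r else 0)"
    unfolding R_def R_val_def R_upto_eq_suminf Q_def Q_set_def ..
  have \<delta>_eq: "\<delta> = (\<Prod>q\<in>Q. 1 / (real q - real (pair_roots k q)))"
    unfolding \<delta>_def using Q by (intro prod.cong refl) (simp add: pair_roots_prime inverse_eq_divide)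
  have nd: "\<not> q dvd a * (a + k)" if "q \<in> Q" for q
    unfolding a_def using that finQ P0 s Q(3)[OF that]
    by (intro shift_class_not_dvd Q(1)[OF that]) (auto simp: dvd_prod_eqI)
  have lim1: "((\<lambda>x. real (card (D x)) / \<pi> x) \<longlongrightarrow> \<delta>) at_top"
    unfolding D_def \<pi>_def \<delta>_eq using finQ Q(1) nd by (intro prime_pairs_class_proportion[OF BH k]) auto
  have lim2: "((\<lambda>x. (\<Sum>p\<in>D x. opposing_sum k s Q p) / \<pi> x) \<longlongrightarrow> \<delta> * R) at_top"
    unfolding D_def \<pi>_def \<delta>_eq R_eq using finQ Q(1) nd by (intro mean_opposing_sum[OF BH k s]) auto
  have \<pi>_top: "filterlim \<pi> at_top at_top"
    unfolding \<pi>_def by (rule card_pairs_upto_at_top[OF BH k])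
  have lower: "ereal (\<delta> * (1 - R / (L - \<epsilon>))) \<le> lower_density_in G (prime_pairs k)"
    if \<epsilon>: "0 < \<epsilon>" "\<epsilon> < L" for \<epsilon>
  proof -
    obtain N where N: "\<And>p s. p > N \<Longrightarrow> prime p \<Longrightarrow>
         ln (real (shifted k s p)) - ln (real (shifted k (-s) p)) < \<epsilon>"
      using ln_shifted_ratio_small[OF \<epsilon>(1), of k] by blast
    \<comment> \<open>The finitely many primes below \<open>m\<close> do not affect the density.\<close>
    define m where "m = max N k + 1"
    have good: "p \<in> G" if p: "p \<in> D x" "p \<ge> m" "opposing_sum k s Q p \<le> L - \<epsilon>" for p x
    proof -
      have pp: "p \<in> prime_pairs k" "[p = a] (mod \<Prod>Q)" using p(1) by (auto simp: D_def pairs_upto_def)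
      then have pr: "prime p" by (simp add: prime_pairs_def)
      have "\<Prod>Q dvd shifted k s p"
        using pp(2) dvd_shifted_iff[OF prime_gt_0_nat[OF pr] P0] by (simp add: a_def)
      moreover have "ln (real (shifted k s p)) - ln (real (shifted k (-s) p)) + opposing_sum k s Q p < (\<Sum>q\<in>Q. prime_log q)"
      proof -
        have "p > N" using p(2) by (simp add: m_def)
        then show ?thesis using N[of p s] pr p(3) L_eq by linarith
      qed
      ultimately have "sgn (T k p) = s"
        using pp(1) p(2) k(2) k3 s finQ Q by (intro opposing_sum_small_imp_sgn_T) (auto simp: m_def)
      then show ?thesis using pp(1) by (simp add: G_def)
    qed
    have count: "real (card (D x)) - (\<Sum>p\<in>D x. opposing_sum k s Q p) / (L - \<epsilon>) - real m
        \<le> real (card {p\<in>G. real p \<le> x})" for x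
    proof -
      define B where "B = {p\<in>D x. opposing_sum k s Q p > L - \<epsilon>}"
      have fD: "finite (D x)" unfolding D_def using finite_pairs_upto[of k x] by (rule rev_finite_subset) auto
      have fG: "finite {p\<in>G. real p \<le> x}"
        using finite_pairs_upto[of k x] by (rule rev_finite_subset) (auto simp: G_def pairs_upto_def)
      have nn: "opposing_sum k s Q p \<ge> 0" for p
        unfolding opposing_sum_def by (intro sum_nonneg prime_log_nonneg) auto
      \<comment> \<open>Markov's inequality for the opposing sum.\<close>
      have "(L - \<epsilon>) * real (card B) = (\<Sum>p\<in>B. L - \<epsilon>)" by simp
      also have "\<dots> \<le> (\<Sum>p\<in>B. opposing_sum k s Q p)" by (intro sum_mono) (auto simp: B_def)
      also have "\<dots> \<le> (\<Sum>p\<in>D x. opposing_sum k s Q p)"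
        using fD nn by (intro sum_mono2) (auto simp: B_def)
      finally have markov: "real (card B) \<le> (\<Sum>p\<in>D x. opposing_sum k s Q p) / (L - \<epsilon>)"
        using \<epsilon> by (simp add: field_simps)
      have "D x \<subseteq> B \<union> {..<m} \<union> {p\<in>G. real p \<le> x}"
        using good by (fastforce simp: B_def D_def pairs_upto_def)
      then have "card (D x) \<le> card (B \<union> {..<m} \<union> {p\<in>G. real p \<le> x})"
        using fD fG by (intro card_mono) (auto simp: B_def)
      also have "\<dots> \<le> card B + card {..<m} + card {p\<in>G. real p \<le> x}"
        by (meson add_right_mono card_Un_le le_trans)
      finally show ?thesis using markov by simp
    qed
    have "((\<lambda>x. real (card (D x)) / \<pi> x - (\<Sum>p\<in>D x. opposing_sum k s Q p) / \<pi> x / (L - \<epsilon>) - real m / \<pi> x)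
        \<longlongrightarrow> \<delta> - \<delta> * R / (L - \<epsilon>) - 0) at_top"
      using \<epsilon> by (intro tendsto_diff tendsto_divide lim1 lim2 tendsto_const
          tendsto_divide_0[OF tendsto_const filterlim_at_top_imp_at_infinity[OF \<pi>_top]]) auto
    then have lim: "((\<lambda>x. ereal (real (card (D x)) / \<pi> x - (\<Sum>p\<in>D x. opposing_sum k s Q p) / \<pi> x / (L - \<epsilon>) - real m / \<pi> x))
        \<longlongrightarrow> ereal (\<delta> * (1 - R / (L - \<epsilon>)))) at_top"
      by (simp add: right_diff_distrib)
    have "ereal (\<delta> * (1 - R / (L - \<epsilon>))) = Liminf at_top (\<lambda>x. ereal (real (card (D x)) / \<pi> x
         - (\<Sum>p\<in>D x. opposing_sum k s Q p) / \<pi> x / (L - \<epsilon>) - real m / \<pi> x))"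
      using lim by (intro lim_imp_Liminf[symmetric]) auto
    also have "\<dots> \<le> lower_density_in G (prime_pairs k)"
      unfolding lower_density_in_def
    proof (intro Liminf_mono always_eventually allI)
      fix x :: real
      have "real (card (D x)) / \<pi> x - (\<Sum>p\<in>D x. opposing_sum k s Q p) / \<pi> x / (L - \<epsilon>) - real m / \<pi> x
          = (real (card (D x)) - (\<Sum>p\<in>D x. opposing_sum k s Q p) / (L - \<epsilon>) - real m) / \<pi> x"
        by (simp add: diff_divide_distrib mult.commute)
      also have "\<dots> \<le> real (card {p\<in>G. real p \<le> x}) / \<pi> x"
        using count[of x] by (intro divide_right_mono) (auto simp: \<pi>_def)
      finally show "ereal (real (card (D x)) / \<pi> x - (\<Sum>p\<in>D x. opposing_sum k s Q p) / \<pi> x / (L - \<epsilon>) - real m / \<pi> x)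
         \<le> ereal (real (card {p\<in>G. real p \<le> x}) / real (card {p\<in>prime_pairs k. real p \<le> x}))"
        by (simp add: \<pi>_def pairs_upto_def)
    qed
    finally show ?thesis .
  qed
  have "((\<lambda>\<epsilon>. ereal (\<delta> * (1 - R / (L - \<epsilon>)))) \<longlongrightarrow> ereal (\<delta> * (1 - R / (L - 0)))) (at_right 0)"
    using R by (intro tendsto_intros) auto
  moreover have "eventually (\<lambda>\<epsilon>. ereal (\<delta> * (1 - R / (L - \<epsilon>))) \<le> lower_density_in G (prime_pairs k)) (at_right 0)"
    using R lower by (auto simp: eventually_at_right_field intro!: exI[of _ L])
  ultimately have "ereal (\<delta> * (1 - R / (L - 0))) \<le> lower_density_in G (prime_pairs k)"
    by (rule tendsto_upperbound) auto
  moreover have "\<delta> * (1 - R / L) > 0"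
    using \<delta>0 R by (intro mult_pos_pos) (auto simp: field_simps)
  ultimately show ?thesis
    by (simp add: \<delta>_def R_def L_def G_def Q_def)
qed

end
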